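(* Assume that $X=(X,d,\mu)$ is a complete geodesic space. Let $1<p<\infty$ and $0<\beta\le1$, and assume that there are an exponent $\sigma>\beta p$ and a constant $c_\sigma>0$ such that $$\frac{\mu(B(x,r))}{\mu(B(x,R))}\le c_\sigma\Bigl(\frac rR\Bigr)^\sigma$$ for all $x\in X$ and all $0<r<R\le2\operatorname{diam}(X)$. If a closed set $E\subset X$ satisfies the Riesz $(\beta,p)$-capacity density condition, then there exists $0<\delta<\min\{\beta,p-1\}$ such that $E$ satisfies the Riesz $(\gamma,s)$-capacity density condition whenever $\beta-\delta<\gamma\le1$, $p-\delta<s<\infty$ and $\sigma>\gamma s$.
   Context: Standing assumptions: $X=(X,d,\mu)$ is a metric measure space with at least two points, equipped with a metric $d$ and a positive complete Borel measure $\mu$ such that $0<\mu(B)<\infty$ for all balls $B\subset X$. Balls are open, $B(x,r)=\{y\in X: d(y,x)<r\}$, and $\overline{B(x,r)}$ denotes the closure. The measure $\mu$ is doubling: there is a constant $c_\mu>1$ with $\mu(B(x,2r))\le c_\mu\,\mu(B(x,r))$ for all $x\in X$, $r>0$. Diameters may be $\infty$. $X$ is geodesic if every pair of points can be joined by a (rectifiable, continuous) curve whose length equals the distance between the points. Riesz potential and Riesz capacity: for a nonnegative measurable function $f$ on $X$ and $\beta>0$, $$I_\beta f(x)=\int_X \frac{f(y)\,d(x,y)^\beta}{\mu(B(x,d(x,y)))}\,d\mu(y),\qquad x\in X.$$ For $F\subset X$ and $p\ge1$, $R_{\beta,p}(F)=\inf\{\|f\|_{L^p(X)}^p : f\ge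 0 \text{ and } I_\beta f\ge 1 \text{ on } F\}$. For $1\le p<\infty$ and $\beta>0$, a closed set $E\subset X$ satisfies the Riesz $(\beta,p)$-capacity density condition if there is $c_0>0$ such that $R_{\beta,p}(E\cap\overline{B(x,r)})\ge c_0\,R_{\beta,p}(\overline{B(x,r)})$ for all $x\in E$ and all $0<r<(1/8)\operatorname{diam}(E)$. *)

theory Defs
  imports "HOL-Analysis.Analysis"
begin

text \<open>
  The space \<open>X\<close> is the whole type \<open>'a\<close>; the measure may be defined on any
  complete sigma-algebra containing the Borel sets.
\<close>

locale doubling_metric_measure_space = complete_measure M
  for M :: "'a::metric_space measure" +
  assumes two_points: "\<exists>x y :: 'a. x \<noteq> y"
    and borel_sets: "sets borel \<subseteq> sets M"
    and ball_pos: "r > 0 \<Longrightarrow> 0 < emeasure M (ball x r)"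
    and ball_finite: "r > 0 \<Longrightarrow> emeasure M (ball x r) < \<infinity>"
    and doubling: "\<exists>c>1. \<forall>x. \<forall>r>0. measure M (ball x (2 * r)) \<le> c * measure M (ball x r)"

text \<open>
  The library's \<^const>\<open>diameter\<close> is real-valued and carries no information for
  unbounded sets, whereas infinite diameters are allowed here.
\<close>

definition ediameter :: "'a::metric_space set \<Rightarrow> ennreal" where
  "ediameter S = (SUP x\<in>S. SUP y\<in>S. ennreal (dist x y))"

definition curve_length :: "(real \<Rightarrow> 'a::metric_space) \<Rightarrow> ennreal" where
  "curve_length g =
     (SUP (n, t) \<in> {(n :: nat, t :: nat \<Rightarrow> real). mono t \<and> range t \<subseteq> {0..1}}.
        \<Sum>i<n. ennreal (dist (g (t i)) (g (t (Suc i)))))"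

definition geodesic_space :: "'a::metric_space itself \<Rightarrow> bool" where
  "geodesic_space TYPE('a) \<longleftrightarrow>
     (\<forall>x y :: 'a. \<exists>g. path g \<and> pathstart g = x \<and> pathfinish g = y \<and>
                     curve_length g = ennreal (dist x y))"

text \<open>
  On the diagonal \<open>y = x\<close> the kernel has the form \<open>0 / 0\<close> and is read as \<open>0\<close>.
  In a connected doubling space with at least two points, singletons are null
  sets, so this convention does not affect the integral there.
\<close>

definition riesz_potential ::
    "'a::metric_space measure \<Rightarrow> real \<Rightarrow> ('a \<Rightarrow> real) \<Rightarrow> 'a \<Rightarrow> ennreal" where
  "riesz_potential M \<beta> f x =
     (\<integral>\<^sup>+ y. ennreal (f y * dist x y powr \<beta> / measure M (ball x (dist x y))) \<partial>M)"

text \<open>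
  Test functions are finite-valued. Allowing the value \<open>\<infinity>\<close> would give the same
  infimum: a function with finite norm can be changed on a null set, which affects
  neither its norm nor its potential. If there is no admissible function, the
  infimum is \<open>\<infinity>\<close>.
\<close>

definition riesz_capacity ::
    "'a::metric_space measure \<Rightarrow> real \<Rightarrow> real \<Rightarrow> 'a set \<Rightarrow> ennreal" where
  "riesz_capacity M \<beta> p F =
     (INF f \<in> {f \<in> borel_measurable M. (\<forall>x. 0 \<le> f x) \<and> (\<forall>x\<in>F. 1 \<le> riesz_potential M \<beta> f x)}.
        \<integral>\<^sup>+ x. ennreal (f x powr p) \<partial>M)"

text \<open>
  The closed sets below are closures of open balls, as opposed to \<^const>\<open>cball\<close>.
\<close>

definition riesz_capacity_density ::
    "'a::metric_space measure \<Rightarrow> real \<Rightarrow> real \<Rightarrow> 'a set \<Rightarrow> bool" where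
  "riesz_capacity_density M \<beta> p E \<longleftrightarrow>
     (\<exists>c\<^sub>0>0. \<forall>x\<in>E. \<forall>r>0. ennreal r < ediameter E / 8 \<longrightarrow>
        riesz_capacity M \<beta> p (E \<inter> closure (ball x r))
          \<ge> ennreal c\<^sub>0 * riesz_capacity M \<beta> p (closure (ball x r)))"

end

theory Submission
  imports Defs
begin

text \<open>
  Call \<open>r\<^sup>-\<^sup>q \<mu>(B(x,r))\<close> the \<open>q\<close>-weight of a ball, and say that \<open>E\<close> branches with exponent \<open>q\<close>
  if every ball centred in \<open>E\<close> contains disjoint balls centred in \<open>E\<close>, all of one smaller but
  comparable radius, whose \<open>q\<close>-weights sum up to at least its own.

  Density implies branching: test the \<open>(\<beta>,p)\<close>-capacity of \<open>E \<inter> B(x,r)\<close> with a sum over \<open>N\<close> dyadic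
  scales \<open>t\<close> of \<open>N\<^sup>-\<^sup>1 t\<^sup>-\<^sup>\<beta>\<close> times the indicator of the \<open>t\<close>-neighbourhood of \<open>E \<inter> B(x,r)\<close>. As \<open>p > 1\<close>,
  the density condition forces one of the scales to carry \<open>\<beta>p\<close>-weight at least \<open>N\<^sup>p\<^sup>-\<^sup>1\<close> times that of
  \<open>B(x,r)\<close>, up to a constant. For large \<open>N\<close> the surplus absorbs the change from the exponent \<open>\<beta>p\<close> to
  some \<open>q < \<beta>p\<close>.

  Branching implies \<open>(\<gamma>,s)\<close>-density whenever \<open>q < \<gamma>s < \<sigma>\<close>: given an admissible \<open>f\<close>, descend from \<open>B(x,r)\<close>
  through a branching, always to a ball in which the ratio of \<open>\<integral> f\<^sup>s\<close> to the \<open>q\<close>-weight does not grow. At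
  the limit point \<open>y \<in> E\<close> this bounds the means of \<open>f\<^sup>s\<close> over all \<open>B(y,t)\<close>, \<open>t \<le> r\<close>, while reverse
  doubling takes care of \<open>t > r\<close>; summing over dyadic annuli gives
  \<open>1 \<le> I\<^sub>\<gamma> f(y) \<le> c (r\<^sup>\<gamma>\<^sup>s \<mu>(B(x,r))\<^sup>-\<^sup>1 \<integral> f\<^sup>s)\<^sup>1\<^sup>/\<^sup>s\<close>.
\<close>

section \<open>Geometric sums over scales\<close>

lemma geometric_sum_le:
  fixes g :: real
  assumes "g > 1"
  shows "(\<Sum>k\<le>j. g ^ k) \<le> g / (g - 1) * g ^ j"
proof -
  have "(\<Sum>k\<le>j. g ^ k) = (g ^ Suc j - 1) / (g - 1)"
    using assms geometric_sum[of g "Suc j"] by (simp add: lessThan_Suc_atMost)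
  also have "\<dots> \<le> g ^ Suc j / (g - 1)" using assms by (intro divide_right_mono) auto
  finally show ?thesis by simp
qed

text \<open>The sets are nested, so the nonzero terms at \<open>z\<close> form an initial segment of
  a geometric sequence, and their sum is comparable to the last term. Hence the power passes inside
  the sum at a cost independent of \<open>N\<close>.\<close>

lemma powr_scales_sum_le:
  fixes g A :: real and D :: "nat \<Rightarrow> 'b set"
  assumes g: "g > 1" and A: "A \<ge> 0" and p: "p > 0" and a: "a \<ge> 0"
    and dec: "\<And>i k. i \<le> k \<Longrightarrow> D k \<subseteq> D i"
  shows "(A * (\<Sum>k<N. a * g ^ k * indicator (D k) z)) powr p
    \<le> (A * (g / (g - 1))) powr p * (\<Sum>k<N. (a * g ^ k) powr p * indicator (D k) z)"
proof (cases "\<exists>k<N. z \<in> D k")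
  case False
  then have "(\<Sum>k<N. a * g ^ k * indicator (D k) z) = 0" by (intro sum.neutral) auto
  then show ?thesis using p by (auto intro!: mult_nonneg_nonneg sum_nonneg)
next
  case True
  \<comment> \<open>The deepest scale whose set still contains \<open>z\<close>.\<close>
  define j where "j = Max {k. k < N \<and> z \<in> D k}"
  have "j \<in> {k. k < N \<and> z \<in> D k}" unfolding j_def using True by (intro Max_in) auto
  then have j: "j < N" "z \<in> D j" by auto
  have jmax: "k \<le> j" if "k < N" "z \<in> D k" for k
    unfolding j_def using that by (intro Max_ge) auto
  have inside: "z \<in> D k" if "k \<le> j" for k using dec[OF that] j(2) by auto
  have outside: "z \<notin> D k" if "k < N" "\<not> k \<le> j" for k using that jmax by blast
  have "(\<Sum>k<N. a * g ^ k * indicator (D k) z) = (\<Sum>k\<le>j. a * g ^ k)"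
    using j(1) inside outside by (intro sum.mono_neutral_cong_right) auto
  also have "\<dots> \<le> a * (g / (g - 1) * g ^ j)"
    unfolding sum_distrib_left[symmetric] using geometric_sum_le[OF g] a by (intro mult_left_mono)
  finally have "A * (\<Sum>k<N. a * g ^ k * indicator (D k) z) \<le> A * (a * (g / (g - 1) * g ^ j))"
    using A by (rule mult_left_mono)
  also have "\<dots> = A * (g / (g - 1)) * (a * g ^ j)" by (simp add: mult_ac)
  finally have "A * (\<Sum>k<N. a * g ^ k * indicator (D k) z) \<le> A * (g / (g - 1)) * (a * g ^ j)" .
  then have "(A * (\<Sum>k<N. a * g ^ k * indicator (D k) z)) powr p
      \<le> (A * (g / (g - 1)) * (a * g ^ j)) powr p"
    using A a g p by (intro powr_mono2) (auto intro!: mult_nonneg_nonneg sum_nonneg)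
  also have "\<dots> = (A * (g / (g - 1))) powr p * (a * g ^ j) powr p"
    using A a g by (intro powr_mult)
  also have "(a * g ^ j) powr p = (a * g ^ j) powr p * indicator (D j) z" using j by simp
  also have "\<dots> \<le> (\<Sum>k<N. (a * g ^ k) powr p * indicator (D k) z)"
    using j by (intro member_le_sum) auto
  finally show ?thesis by (simp add: mult_left_mono)
qed

section \<open>Doubling and reverse doubling\<close>

text \<open>Names the constants, so that the bounds below are uniform in centre and radius. The
  product form of reverse doubling agrees with the quotient form because balls of positive radius
  have positive measure.\<close>

locale reverse_doubling_space = doubling_metric_measure_space M
  for M :: "'a::metric_space measure" +
  fixes C cs \<sigma> :: real
  assumes C_gt_1: "C > 1"
    and dbl: "r > 0 \<Longrightarrow> measure M (ball x (2 * r)) \<le> C * measure M (ball x r)"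
    and cs_pos: "cs > 0"
    and \<sigma>_pos: "\<sigma> > 0"
    and reverse_dbl: "0 < r \<Longrightarrow> r < R \<Longrightarrow> ennreal R \<le> 2 * ediameter (UNIV :: 'a set) \<Longrightarrow>
           measure M (ball x r) \<le> cs * (r / R) powr \<sigma> * measure M (ball x R)"
begin

section \<open>Measures of balls\<close>

abbreviation m :: "'a \<Rightarrow> real \<Rightarrow> real" where
  "m x r \<equiv> measure M (ball x r)"

lemma borel_in_sets: "S \<in> sets borel \<Longrightarrow> S \<in> sets M"
  using borel_sets by blast

lemma open_in_sets [measurable, intro]: "open S \<Longrightarrow> S \<in> sets M"
  by (rule borel_in_sets) simp

lemma space_UNIV: "space M = UNIV"
  using sets.sets_into_space[OF open_in_sets[OF open_UNIV]] by auto

lemma borel_measurable_of_borel: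
  "f \<in> borel_measurable borel \<Longrightarrow> f \<in> borel_measurable M"
  by (rule measurableI) (auto simp: space_UNIV dest: measurable_sets intro!: borel_in_sets)

lemma emeasure_ball: "emeasure M (ball x r) = ennreal (m x r)"
proof (cases "r > 0")
  case True
  then show ?thesis using ball_finite[of r x] by (intro emeasure_eq_ennreal_measure) auto
next
  case False
  then have "ball x r = {}" by simp
  then show ?thesis by (simp only: measure_empty emeasure_empty ennreal_0)
qed

lemma m_pos: "r > 0 \<Longrightarrow> m x r > 0"
  using ball_pos[of r x] emeasure_ball[of x r] by simp

lemma m_nonneg: "m x r \<ge> 0" by simp

lemma m_mono: "ball x r \<subseteq> ball y R \<Longrightarrow> m x r \<le> m y R"
  using emeasure_mono[of "ball x r" "ball y R" M] by (simp add: emeasure_ball)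

lemma m_mono_dist: "dist x y + r \<le> R \<Longrightarrow> m x r \<le> m y R"
proof (rule m_mono, rule subsetI)
  fix z assume "dist x y + r \<le> R" "z \<in> ball x r"
  then show "z \<in> ball y R"
    using dist_triangle[of y z x] by (simp add: dist_commute)
qed

lemma m_pow: "r > 0 \<Longrightarrow> m x (2 ^ n * r) \<le> C ^ n * m x r"
proof (induction n)
  case (Suc n)
  have "m x (2 ^ Suc n * r) = m x (2 * (2 ^ n * r))" by (simp add: algebra_simps)
  also have "\<dots> \<le> C * m x (2 ^ n * r)" using Suc by (intro dbl) simp
  also have "\<dots> \<le> C * (C ^ n * m x r)" using Suc C_gt_1 by (intro mult_left_mono) auto
  finally show ?case by (simp add: algebra_simps)
qed simp

text \<open>Compares different centres: \<open>ball x R\<close> lies in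
  \<open>ball y (2 ^ n * r)\<close>, to which \<open>n\<close> doublings apply.\<close>

lemma m_le_pow:
  assumes "r > 0" "dist x y + R \<le> 2 ^ n * r"
  shows "m x R \<le> C ^ n * m y r"
  using m_mono_dist[OF assms(2)] m_pow[OF assms(1), of y n] by linarith

section \<open>The Riesz kernel and separated nets\<close>

definition ker :: "real \<Rightarrow> 'a \<Rightarrow> 'a \<Rightarrow> real" where
  "ker b x y = dist x y powr b / m x (dist x y)"

lemma ker_nonneg: "ker b x y \<ge> 0"
  by (simp add: ker_def)

text \<open>The mass of a ball is monotone in the radius, hence a Borel function of it, and the
  distance to \<open>x\<close> is continuous.\<close>

lemma ker_measurable [measurable]: "ker b x \<in> borel_measurable M"
proof -
  have "mono (m x)" by (intro monoI m_mono_dist) simp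
  then have [measurable]: "m x \<in> borel_measurable borel" by (rule borel_measurable_mono)
  have [measurable]: "dist x \<in> borel_measurable borel"
    by (intro borel_measurable_continuous_onI continuous_intros)
  have [measurable]: "(\<lambda>y. m x (dist x y)) \<in> borel_measurable borel"
    by (rule measurable_compose[of "dist x" _ borel]) measurable
  have "(\<lambda>y. dist x y powr b / m x (dist x y)) \<in> borel_measurable borel"
    by measurable
  then show ?thesis unfolding ker_def by (rule borel_measurable_of_borel)
qed

lemma riesz_potential_ker:
  "riesz_potential M b f x = (\<integral>\<^sup>+ y. ennreal (f y * ker b x y) \<partial>M)"
  by (simp add: riesz_potential_def ker_def)

text \<open>For this \<eta>, reverse doubling leaves at most half of the mass of a ball in the
  concentric ball shrunk by \<eta>, so the annulus between them carries the other half.\<close>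

lemma exists_eta:
  obtains \<eta> where "0 < \<eta>" "\<eta> < 1" "cs * \<eta> powr \<sigma> \<le> 1 / 2"
proof -
  define \<eta> where "\<eta> = min (1/2) ((1 / (2 * cs)) powr (1 / \<sigma>))"
  have "\<eta> powr \<sigma> \<le> ((1 / (2 * cs)) powr (1 / \<sigma>)) powr \<sigma>"
    using \<sigma>_pos cs_pos by (intro powr_mono2) (auto simp: \<eta>_def)
  also have "\<dots> = 1 / (2 * cs)" using \<sigma>_pos cs_pos by (simp add: powr_powr)
  finally have "cs * \<eta> powr \<sigma> \<le> 1 / 2" using cs_pos by (simp add: field_simps)
  then show ?thesis using cs_pos by (intro that[of \<eta>]) (auto simp: \<eta>_def)
qed

text \<open>Only the annulus \<open>\<eta> * t \<le> dist y z < t\<close> is used: there the kernel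
  is at least \<open>(\<eta> * t) powr b / m y t\<close>, and the mass is at least
  \<open>m y t / 2\<close>.\<close>

lemma ker_integral_ball_ge:
  assumes eta: "0 < \<eta>" "\<eta> < 1" "cs * \<eta> powr \<sigma> \<le> 1 / 2"
    and b: "b \<ge> 0" and t: "t > 0" "ennreal t \<le> 2 * ediameter (UNIV :: 'a set)"
  shows "ennreal (\<eta> powr b / 2 * t powr b) \<le> (\<integral>\<^sup>+ z. ennreal (ker b y z) * indicator (ball y t) z \<partial>M)"
proof -
  define A where "A = ball y t - ball y (\<eta> * t)"
  have A [measurable]: "A \<in> sets M" unfolding A_def by auto
  have mt: "m y t > 0" using t m_pos by auto
  have sub: "ball y (\<eta> * t) \<subseteq> ball y t" using eta t by (intro subset_ball) auto
  have "m y (\<eta> * t) \<le> cs * \<eta> powr \<sigma> * m y t"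
    using reverse_dbl[of "\<eta> * t" t y] eta t by simp
  also have "\<dots> \<le> 1 / 2 * m y t" using eta by (intro mult_right_mono) auto
  finally have half: "m y (\<eta> * t) \<le> m y t / 2" by simp
  have "emeasure M A = ennreal (m y t) - ennreal (m y (\<eta> * t))"
    unfolding A_def using sub by (subst emeasure_Diff) (auto simp: emeasure_ball)
  also have "\<dots> = ennreal (m y t - m y (\<eta> * t))" by (simp add: ennreal_minus)
  finally have EA: "emeasure M A = ennreal (m y t - m y (\<eta> * t))" .
  have "ennreal (\<eta> powr b / 2 * t powr b) \<le> ennreal ((\<eta> * t) powr b / m y t * (m y t - m y (\<eta> * t)))"
  proof (rule ennreal_leI)
    have "\<eta> powr b / 2 * t powr b = (\<eta> * t) powr b / m y t * (m y t / 2)"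
      using mt eta t by (simp add: powr_mult)
    also have "\<dots> \<le> (\<eta> * t) powr b / m y t * (m y t - m y (\<eta> * t))"
      using half mt by (intro mult_left_mono) auto
    finally show "\<eta> powr b / 2 * t powr b \<le> (\<eta> * t) powr b / m y t * (m y t - m y (\<eta> * t))" .
  qed
  also have "\<dots> = ennreal ((\<eta> * t) powr b / m y t) * emeasure M A"
    unfolding EA by (rule ennreal_mult) (use half mt in auto)
  also have "\<dots> = (\<integral>\<^sup>+ z. ennreal ((\<eta> * t) powr b / m y t) * indicator A z \<partial>M)"
    by (simp add: nn_integral_cmult_indicator)
  also have "\<dots> \<le> (\<integral>\<^sup>+ z. ennreal (ker b y z) * indicator (ball y t) z \<partial>M)"
  proof (rule nn_integral_mono)
    fix z
    show "ennreal ((\<eta> * t) powr b / m y t) * indicator A z \<le> ennreal (ker b y z) * indicator (ball y t) z"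
    proof (cases "z \<in> A")
      case True
      then have z: "\<eta> * t \<le> dist y z" "dist y z < t" by (auto simp: A_def)
      then have dp: "dist y z > 0" using eta t by (meson less_le_trans mult_pos_pos)
      have "(\<eta> * t) powr b \<le> dist y z powr b" using z eta t b by (intro powr_mono2) auto
      moreover have "m y (dist y z) \<le> m y t" using z by (intro m_mono_dist) simp
      ultimately have "(\<eta> * t) powr b / m y t \<le> ker b y z"
        unfolding ker_def using m_pos[OF dp] by (intro frac_le) auto
      then show ?thesis using True by (auto simp: A_def intro!: ennreal_leI)
    qed simp
  qed
  finally show ?thesis .
qed

text \<open>A Vitali argument: for a disjoint family of \<open>t\<close>-balls centred in
  \<open>F\<close> with maximal cardinality, the fourfold enlargements cover the
  \<open>t\<close>-neighbourhood of \<open>F\<close>, and two doublings give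
  \<open>C\<^sup>2\<close>.\<close>

lemma separated_net:
  assumes F: "F \<subseteq> cball x (r / 4)" and r: "r > 0" and t: "0 < t" "t \<le> r / 8"
  obtains S where "finite S" "S \<subseteq> F" "disjoint_family_on (\<lambda>z. ball z t) S"
    "emeasure M (\<Union>y\<in>F. ball y t) \<le> ennreal (C\<^sup>2 * (\<Sum>z\<in>S. m z t))"
proof -
  define P where "P S \<longleftrightarrow> finite S \<and> S \<subseteq> F \<and> disjoint_family_on (\<lambda>z. ball z t) S" for S
  \<comment> \<open>So large that the ball of radius \<open>2 ^ n * t\<close> around any point of
    \<open>F\<close> contains \<open>ball x r\<close>.\<close>
  obtain n where n: "2 * r / t < 2 ^ n" using real_arch_pow[of 2 "2 * r / t"] by auto
  have lower: "m x r \<le> C ^ n * m z t" if "z \<in> F" for z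
  proof (rule m_le_pow)
    have "dist x z \<le> r / 4" using that F by auto
    moreover have "2 * r < 2 ^ n * t" using n t by (simp add: field_simps)
    ultimately show "dist x z + r \<le> 2 ^ n * t" using r by linarith
  qed fact
  \<comment> \<open>The balls are disjoint, lie in \<open>ball x r\<close> and each have at least
    the share \<open>1 / C ^ n\<close> of its mass, which bounds their number.\<close>
  have "card S \<le> nat \<lceil>C ^ n\<rceil>" if "P S" for S
  proof -
    have "real (card S) * m x r = (\<Sum>z\<in>S. m x r)" by simp
    also have "\<dots> \<le> (\<Sum>z\<in>S. C ^ n * m z t)"
      using that lower by (intro sum_mono) (auto simp: P_def)
    also have "\<dots> = C ^ n * (\<Sum>z\<in>S. m z t)" by (simp add: sum_distrib_left)
    also have "(\<Sum>z\<in>S. m z t) = measure M (\<Union>z\<in>S. ball z t)"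
      using that by (intro measure_finite_Union[symmetric])
        (auto simp: P_def emeasure_ball)
    also have "\<dots> \<le> m x r"
    proof (rule measure_mono_fmeasurable)
      show "(\<Union>z\<in>S. ball z t) \<subseteq> ball x r"
      proof
        fix w assume "w \<in> (\<Union>z\<in>S. ball z t)"
        then obtain z where "z \<in> S" "dist z w < t" by auto
        moreover have "dist x z \<le> r / 4" using \<open>z \<in> S\<close> that F by (auto simp: P_def)
        ultimately show "w \<in> ball x r" using dist_triangle[of x w z] t r by (simp add: mem_ball)
      qed
      show "ball x r \<in> fmeasurable M" by (auto simp: fmeasurable_def emeasure_ball)
    qed auto
    finally have "real (card S) * m x r \<le> C ^ n * m x r" using C_gt_1 by simp
    then have "real (card S) \<le> C ^ n" using m_pos[OF r, of x] by simp
    then show ?thesis by linarith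
  qed
  then obtain S where S: "P S" and max: "\<And>S'. P S' \<Longrightarrow> card S' \<le> card S"
    using ex_has_greatest_nat[of P "{}" card "Suc (nat \<lceil>C ^ n\<rceil>)"]
    by (auto simp: P_def less_Suc_eq_le disjoint_family_on_def)
  \<comment> \<open>By maximality the ball around \<open>y\<close> meets one around some
    \<open>z \<in> S\<close>. Then \<open>dist z w < 3 * t\<close>, and 4 is the next power of
    two.\<close>
  have cover: "(\<Union>y\<in>F. ball y t) \<subseteq> (\<Union>z\<in>S. ball z (2\<^sup>2 * t))"
  proof
    fix w assume "w \<in> (\<Union>y\<in>F. ball y t)"
    then obtain y where y: "y \<in> F" "dist y w < t" by auto
    have "\<exists>z\<in>S. ball y t \<inter> ball z t \<noteq> {}"
    proof (rule ccontr)
      assume *: "\<not> ?thesis"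
      then have "y \<notin> S" using t by auto
      have "P (insert y S)" using S y * unfolding P_def disjoint_family_on_def by fastforce
      from max[OF this] show False using \<open>y \<notin> S\<close> S by (auto simp: P_def)
    qed
    then obtain z v where "z \<in> S" "dist y v < t" "dist z v < t" by (auto simp: mem_ball)
    then have "dist z w < 2\<^sup>2 * t"
      using y dist_triangle[of z w v] dist_triangle[of v w y] t by (simp add: dist_commute)
    then show "w \<in> (\<Union>z\<in>S. ball z (2\<^sup>2 * t))" using \<open>z \<in> S\<close> by auto
  qed
  have "emeasure M (\<Union>y\<in>F. ball y t) \<le> emeasure M (\<Union>z\<in>S. ball z (2\<^sup>2 * t))"
    by (rule emeasure_mono[OF cover]) auto
  also have "\<dots> \<le> (\<Sum>z\<in>S. emeasure M (ball z (2\<^sup>2 * t)))"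
    using S by (intro emeasure_subadditive_finite) (auto simp: P_def)
  also have "\<dots> = ennreal (\<Sum>z\<in>S. m z (2\<^sup>2 * t))"
    unfolding emeasure_ball by (rule sum_ennreal) simp
  also have "\<dots> \<le> ennreal (C\<^sup>2 * (\<Sum>z\<in>S. m z t))"
    unfolding sum_distrib_left using t by (intro ennreal_leI sum_mono m_pow) auto
  finally show ?thesis using S by (intro that[of S]) (auto simp: P_def)
qed

section \<open>Upper bounds for the Riesz capacity\<close>

text \<open>On \<open>F\<close> each of the \<open>N\<close> scales contributes at least
  \<open>1 / N\<close> to the potential of the test function \<open>f\<close>. By
  \<open>powr_scales_sum_le\<close> this normalisation enters the bound as
  \<open>N powr (- p)\<close>, against only \<open>N\<close> summands.\<close>

lemma riesz_capacity_le_scales: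
  assumes eta: "0 < \<eta>" "\<eta> < 1" "cs * \<eta> powr \<sigma> \<le> 1 / 2"
    and b: "b > 0" and p: "p > 0" and N: "N > 0"
    and \<tau>: "\<tau> > 0" "ennreal \<tau> \<le> 2 * ediameter (UNIV :: 'a set)"
  shows "riesz_capacity M b p F \<le>
    ennreal ((2 / \<eta> powr b / real N * (2 powr b / (2 powr b - 1))) powr p) *
    (\<Sum>k<N. ennreal ((\<tau> / 2 ^ k) powr (- b * p)) * emeasure M (\<Union>y\<in>F. ball y (\<tau> / 2 ^ k)))"
proof -
  define t where "t k = \<tau> / 2 ^ k" for k :: nat
  \<comment> \<open>\<open>2 / \<eta> powr b\<close> cancels the constant of
    \<open>ker_integral_ball_ge\<close>; dividing by \<open>N\<close> spreads the required value 1
    evenly over the scales.\<close>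
  define A where "A = 2 / \<eta> powr b / real N"
  define g :: real where "g = 2 powr b"
  define a where "a = \<tau> powr (- b)"
  define D where "D k = (\<Union>y\<in>F. ball y (t k))" for k
  define f where "f z = A * (\<Sum>k<N. a * g ^ k * indicator (D k) z)" for z
  have g: "g > 1" unfolding g_def using b by simp
  have A: "A > 0" unfolding A_def using eta N by simp
  have tpos: "t k > 0" for k unfolding t_def using \<tau> by simp
  \<comment> \<open>Halving the radius multiplies the height \<open>t k powr (- b)\<close> by
    \<open>g\<close>, so the heights are geometric as \<open>powr_scales_sum_le\<close>
    requires.\<close>
  have ag: "a * g ^ k = t k powr (- b)" for k
  proof -
    have "g ^ k = (2 ^ k) powr b" unfolding g_def by (simp add: powr_realpow[symmetric] powr_powr mult.commute)
    then show ?thesis unfolding a_def t_def using \<tau> by (simp add: powr_minus powr_divide field_simps)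
  qed
  have [measurable]: "D k \<in> sets M" for k unfolding D_def by auto
  have tle: "t k \<le> t i" if "i \<le> k" for i k
    unfolding t_def using that \<tau> by (intro divide_left_mono) (auto intro: power_increasing)
  have dec: "D k \<subseteq> D i" if "i \<le> k" for i k
    unfolding D_def using tle[OF that] by (intro UN_mono subset_ball) auto
  have [measurable]: "f \<in> borel_measurable M" unfolding f_def by measurable
  have f0: "f z \<ge> 0" for z unfolding f_def using A g
    by (auto simp: a_def intro!: mult_nonneg_nonneg sum_nonneg)
  have adm: "1 \<le> riesz_potential M b f y" if y: "y \<in> F" for y
  proof -
    have small: "ennreal (t k) \<le> 2 * ediameter (UNIV :: 'a set)" for k
      using tle[of 0 k] by (intro order_trans[OF ennreal_leI \<tau>(2)]) (simp add: t_def)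
    have "(1::ennreal) = ennreal (\<Sum>k<N. 1 / real N)" using N by simp
    also have "\<dots> = (\<Sum>k<N. ennreal (1 / real N))" by (intro sum_ennreal[symmetric]) simp
    also have "\<dots> = (\<Sum>k<N. ennreal (A * t k powr (- b)) * ennreal (\<eta> powr b / 2 * t k powr b))"
    proof (rule sum.cong)
      fix k
      have "t k powr (- b) * t k powr b = 1" using tpos[of k] by (simp add: powr_add[symmetric])
      then have "A * t k powr (- b) * (\<eta> powr b / 2 * t k powr b) = A * (\<eta> powr b / 2)"
        by (metis (no_types, opaque_lifting) mult.assoc mult.commute mult.right_neutral)
      also have "\<dots> = 1 / real N" unfolding A_def using eta by simp
      finally have "1 / real N = A * t k powr (- b) * (\<eta> powr b / 2 * t k powr b)" ..
      then show "ennreal (1 / real N) = ennreal (A * t k powr (- b)) * ennreal (\<eta> powr b / 2 * t k powr b)"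
        using A by (simp add: ennreal_mult[symmetric])
    qed simp
    also have "\<dots> \<le> (\<Sum>k<N. ennreal (A * t k powr (- b)) *
        (\<integral>\<^sup>+ z. ennreal (ker b y z) * indicator (ball y (t k)) z \<partial>M))"
      using eta b small tpos by (intro sum_mono mult_left_mono ker_integral_ball_ge) auto
    also have "\<dots> = (\<integral>\<^sup>+ z. (\<Sum>k<N. ennreal (A * t k powr (- b)) *
        (ennreal (ker b y z) * indicator (ball y (t k)) z)) \<partial>M)"
      by (simp add: nn_integral_sum nn_integral_cmult)
    \<comment> \<open>For \<open>y \<in> F\<close> each \<open>ball y (t k)\<close> lies in
      \<open>D k\<close>, so the terms are dominated by those of \<open>f\<close>.\<close>
    also have "\<dots> \<le> (\<integral>\<^sup>+ z. ennreal (f z * ker b y z) \<partial>M)"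
    proof (rule nn_integral_mono)
      fix z
      have "(\<Sum>k<N. ennreal (A * t k powr (- b)) * (ennreal (ker b y z) * indicator (ball y (t k)) z))
        \<le> (\<Sum>k<N. ennreal (A * (a * g ^ k * indicator (D k) z) * ker b y z))"
      proof (rule sum_mono)
        fix k
        show "ennreal (A * t k powr (- b)) * (ennreal (ker b y z) * indicator (ball y (t k)) z)
          \<le> ennreal (A * (a * g ^ k * indicator (D k) z) * ker b y z)"
        proof (cases "z \<in> ball y (t k)")
          case True
          then have "z \<in> D k" using y by (auto simp: D_def)
          then show ?thesis using True A ker_nonneg[of b y z]
            by (simp add: ag ennreal_mult[symmetric])
        qed simp
      qed
      also have "\<dots> = ennreal (\<Sum>k<N. A * (a * g ^ k * indicator (D k) z) * ker b y z)"
        using A g ker_nonneg by (intro sum_ennreal) (auto simp: a_def)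
      also have "(\<Sum>k<N. A * (a * g ^ k * indicator (D k) z) * ker b y z) = f z * ker b y z"
        unfolding f_def by (simp only: sum_distrib_left sum_distrib_right)
      finally show "(\<Sum>k<N. ennreal (A * t k powr (- b)) *
          (ennreal (ker b y z) * indicator (ball y (t k)) z)) \<le> ennreal (f z * ker b y z)" .
    qed
    finally show ?thesis by (simp add: riesz_potential_ker)
  qed
  have "riesz_capacity M b p F \<le> (\<integral>\<^sup>+ z. ennreal (f z powr p) \<partial>M)"
    unfolding riesz_capacity_def using adm f0 by (intro INF_lower) auto
  also have "\<dots> \<le> (\<integral>\<^sup>+ z. ennreal ((A * (g / (g - 1))) powr p) *
      (\<Sum>k<N. ennreal (t k powr (- b * p)) * indicator (D k) z) \<partial>M)"
  proof (rule nn_integral_mono)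
    fix z
    have "f z powr p \<le> (A * (g / (g - 1))) powr p * (\<Sum>k<N. (a * g ^ k) powr p * indicator (D k) z)"
      unfolding f_def using g A p dec by (intro powr_scales_sum_le) (auto simp: a_def)
    also have "(\<Sum>k<N. (a * g ^ k) powr p * indicator (D k) z)
        = (\<Sum>k<N. t k powr (- b * p) * indicator (D k) z)"
      by (simp add: ag powr_powr)
    finally have "ennreal (f z powr p) \<le> ennreal ((A * (g / (g - 1))) powr p *
       (\<Sum>k<N. t k powr (- b * p) * indicator (D k) z))"
      by (rule ennreal_leI)
    also have "\<dots> = ennreal ((A * (g / (g - 1))) powr p) *
       ennreal (\<Sum>k<N. t k powr (- b * p) * indicator (D k) z)"
      by (intro ennreal_mult) (auto intro!: sum_nonneg)
    also have "ennreal (\<Sum>k<N. t k powr (- b * p) * indicator (D k) z)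
       = (\<Sum>k<N. ennreal (t k powr (- b * p)) * indicator (D k) z)"
      by (subst sum_ennreal[symmetric]) (auto intro!: sum.cong simp: indicator_def)
    finally show "ennreal (f z powr p) \<le> ennreal ((A * (g / (g - 1))) powr p) *
      (\<Sum>k<N. ennreal (t k powr (- b * p)) * indicator (D k) z)" .
  qed
  also have "\<dots> = ennreal ((A * (g / (g - 1))) powr p) *
      (\<integral>\<^sup>+ z. (\<Sum>k<N. ennreal (t k powr (- b * p)) * indicator (D k) z) \<partial>M)"
    by (rule nn_integral_cmult) measurable
  also have "(\<integral>\<^sup>+ z. (\<Sum>k<N. ennreal (t k powr (- b * p)) * indicator (D k) z) \<partial>M)
      = (\<Sum>k<N. \<integral>\<^sup>+ z. ennreal (t k powr (- b * p)) * indicator (D k) z \<partial>M)"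
    by (rule nn_integral_sum) measurable
  also have "\<dots> = (\<Sum>k<N. ennreal (t k powr (- b * p)) * emeasure M (D k))"
    by (intro sum.cong nn_integral_cmult_indicator) auto
  finally show ?thesis unfolding A_def g_def D_def t_def .
qed

text \<open>The single scale \<open>r\<close> suffices: the \<open>r\<close>-neighbourhood of the
  closure lies in \<open>ball x (2 * r)\<close>.\<close>

lemma riesz_capacity_ball_le:
  assumes b: "b > 0" and p: "p > 0"
  shows "\<exists>c>0. \<forall>x. \<forall>r>0. ennreal r \<le> 2 * ediameter (UNIV :: 'a set) \<longrightarrow>
     riesz_capacity M b p (closure (ball x r)) \<le> ennreal (c * r powr (- b * p) * m x r)"
proof -
  obtain \<eta> where eta: "0 < \<eta>" "\<eta> < 1" "cs * \<eta> powr \<sigma> \<le> 1 / 2" by (rule exists_eta)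
  define c where "c = (2 / \<eta> powr b * (2 powr b / (2 powr b - 1))) powr p"
  have "(2::real) powr b > 1" using b by simp
  then have c: "c > 0" unfolding c_def using eta b by simp
  show ?thesis
  proof (intro exI[of _ "c * C"] conjI allI impI)
    show "c * C > 0" using c C_gt_1 by simp
    fix x :: 'a and r :: real assume r: "0 < r" "ennreal r \<le> 2 * ediameter (UNIV :: 'a set)"
    have "riesz_capacity M b p (closure (ball x r)) \<le>
        ennreal c * (ennreal (r powr (- b * p)) * emeasure M (\<Union>y\<in>closure (ball x r). ball y r))"
      using riesz_capacity_le_scales[OF eta b p, of 1 r "closure (ball x r)"] r by (simp add: c_def)
    also have "\<dots> \<le> ennreal c * (ennreal (r powr (- b * p)) * ennreal (C * m x r))"
    proof (intro mult_left_mono)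
      have "closure (ball x r) \<subseteq> cball x r" by (rule closure_minimal) (auto simp: less_imp_le)
      moreover have "ball y r \<subseteq> ball x (2 * r)" if "y \<in> cball x r" for y
      proof
        fix z assume "z \<in> ball y r"
        then show "z \<in> ball x (2 * r)" using that dist_triangle[of x z y] by simp
      qed
      ultimately have "(\<Union>y\<in>closure (ball x r). ball y r) \<subseteq> ball x (2 * r)" by blast
      then have "emeasure M (\<Union>y\<in>closure (ball x r). ball y r) \<le> ennreal (m x (2 * r))"
        unfolding emeasure_ball[symmetric] by (intro emeasure_mono) auto
      also have "\<dots> \<le> ennreal (C * m x r)" using r by (intro ennreal_leI dbl)
      finally show "emeasure M (\<Union>y\<in>closure (ball x r). ball y r) \<le> ennreal (C * m x r)" .
    qed auto
    also have "\<dots> = ennreal (c * C * r powr (- b * p) * m x r)"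
      using c C_gt_1 by (simp add: ennreal_mult[symmetric] mult_ac)
    finally show "riesz_capacity M b p (closure (ball x r)) \<le> ennreal (c * C * r powr (- b * p) * m x r)" .
  qed
qed

section \<open>Branching and lower bounds for the Riesz capacity\<close>

text \<open>The factors 1/4 and 1/8 keep children inside their parent and also nest the closed balls
  of half the radius, since \<open>r / 4 + r / 16 \<le> r / 2\<close>. The admissible radii are
  those of the density condition.\<close>

definition branching :: "real \<Rightarrow> real \<Rightarrow> 'a set \<Rightarrow> bool" where
  "branching q l E \<longleftrightarrow> (\<forall>x\<in>E. \<forall>r>0. ennreal r < ediameter E / 8 \<longrightarrow>
     (\<exists>t S. l * r \<le> t \<and> t \<le> r / 8 \<and> finite S \<and> S \<subseteq> E \<inter> cball x (r / 4) \<and>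
        disjoint_family_on (\<lambda>z. ball z t) S \<and>
        r powr (- q) * m x r \<le> (\<Sum>z\<in>S. t powr (- q) * m z t)))"

text \<open>
  Pigeonhole on the disjoint balls of a branching: one of them has no larger density
  \<open>\<nu>(B) / (rad(B)\<^sup>-\<^sup>q \<mu>(B))\<close> than the parent ball.
\<close>

lemma branching_child:
  assumes br: "branching q l E" and x: "x \<in> E" and r: "0 < r" "ennreal r < ediameter E / 8"
    and l: "l > 0"
    and \<nu>: "finite_measure \<nu>" "sets \<nu> = sets M"
    and W: "W \<ge> 0" "measure \<nu> (ball x r) \<le> W * (r powr (- q) * m x r)"
  obtains z t where "z \<in> E" "l * r \<le> t" "t \<le> r / 8" "dist x z \<le> r / 4"
    "measure \<nu> (ball z t) \<le> W * (t powr (- q) * m z t)"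
proof -
  interpret \<nu>: finite_measure \<nu> by fact
  obtain t S where t: "l * r \<le> t" "t \<le> r / 8" and S: "finite S" "S \<subseteq> E \<inter> cball x (r / 4)"
      "disjoint_family_on (\<lambda>z. ball z t) S"
    and sum: "r powr (- q) * m x r \<le> (\<Sum>z\<in>S. t powr (- q) * m z t)"
    using br x r unfolding branching_def by blast
  have "S \<noteq> {}"
  proof
    assume "S = {}"
    then show False using sum m_pos[OF r(1), of x] r(1) by (simp add: mult_le_0_iff)
  qed
  have "\<exists>z\<in>S. measure \<nu> (ball z t) \<le> W * (t powr (- q) * m z t)"
  proof (rule ccontr)
    assume "\<not> ?thesis"
    then have "(\<Sum>z\<in>S. W * (t powr (- q) * m z t)) < (\<Sum>z\<in>S. measure \<nu> (ball z t))"
      using S \<open>S \<noteq> {}\<close> by (intro sum_strict_mono) auto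
    also have "\<dots> = measure \<nu> (\<Union>z\<in>S. ball z t)"
      using S \<nu> by (intro \<nu>.finite_measure_finite_Union[symmetric]) auto
    also have "\<dots> \<le> measure \<nu> (ball x r)"
    proof (rule \<nu>.finite_measure_mono)
      show "(\<Union>z\<in>S. ball z t) \<subseteq> ball x r"
      proof
        fix w assume "w \<in> (\<Union>z\<in>S. ball z t)"
        then obtain z where "z \<in> S" "dist z w < t" by auto
        moreover have "dist x z \<le> r / 4" using \<open>z \<in> S\<close> S by auto
        ultimately show "w \<in> ball x r" using dist_triangle[of x w z] t r by (simp add: mem_ball)
      qed
    qed (use \<nu> in auto)
    also have "\<dots> \<le> W * (r powr (- q) * m x r)" by fact
    also have "\<dots> \<le> W * (\<Sum>z\<in>S. t powr (- q) * m z t)" using sum W by (intro mult_left_mono)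
    finally show False by (simp add: sum_distrib_left)
  qed
  then obtain z where "z \<in> S" "measure \<nu> (ball z t) \<le> W * (t powr (- q) * m z t)" by blast
  then show ?thesis using t S by (intro that[of z t]) auto
qed

text \<open>Iterating \<open>branching_child\<close> gives balls whose \<nu>-mass stays at most
  \<open>W\<close> times their \<open>q\<close>-weight. The centres converge to a point
  \<open>y\<close>, and every \<open>ball y t\<close> lies in a selected ball of comparable radius;
  passing to that ball costs \<open>C ^ k\<close>.\<close>

lemma branching_point:
  assumes br: "branching q l E" and x: "x \<in> E" and r: "0 < r" "ennreal r < ediameter E / 8"
    and l: "l > 0" "4 \<le> 2 ^ k * l" and q: "q > 0"
    and E: "closed E" and compl: "complete (UNIV :: 'a set)"
    and \<nu>: "finite_measure \<nu>" "sets \<nu> = sets M"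
    and W: "W \<ge> 0" "measure \<nu> (ball x r) \<le> W * (r powr (- q) * m x r)"
  obtains y where "y \<in> E" "y \<in> ball x r"
    "\<And>t. 0 < t \<Longrightarrow> t \<le> r / 2 \<Longrightarrow> measure \<nu> (ball y t) \<le> C ^ k * W * t powr (- q) * m y t"
proof -
  interpret \<nu>: finite_measure \<nu> by fact
  \<comment> \<open>The invariant of the descent: the same \<open>W\<close> serves all generations,
    and \<open>u \<le> r\<close> keeps the radii admissible for branching.\<close>
  define I where "I = (\<lambda>(z, u). z \<in> E \<and> 0 < u \<and> u \<le> r \<and>
    measure \<nu> (ball z u) \<le> W * (u powr (- q) * m z u))"
  define Q where "Q = (\<lambda>(z :: 'a, u) (z', u'). l * u \<le> u' \<and> u' \<le> u / 8 \<and> dist z z' \<le> u / 4)"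
  have "\<exists>w'. I w' \<and> Q w w'" if "I w" for w
  proof -
    obtain z u where w: "w = (z, u)" by fastforce
    have zu: "z \<in> E" "0 < u" "u \<le> r" "measure \<nu> (ball z u) \<le> W * (u powr (- q) * m z u)"
      using that by (auto simp: w I_def)
    have "ennreal u < ediameter E / 8" using zu r ennreal_leI[of u r] by (meson le_less_trans)
    from branching_child[OF br zu(1,2) this l(1) \<nu> W(1) zu(4)] obtain z' t
      where zt: "z' \<in> E" "l * u \<le> t" "t \<le> u / 8" "dist z z' \<le> u / 4"
        "measure \<nu> (ball z' t) \<le> W * (t powr (- q) * m z' t)" .
    moreover have "t > 0" using zt(2) zu(2) l(1) by (meson less_le_trans mult_pos_pos)
    ultimately have "I (z', t) \<and> Q w (z', t)" using zu by (auto simp: w I_def Q_def)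
    then show ?thesis ..
  qed
  note succ = this
  have "I (x, r)" using x r W by (simp add: I_def)
  then have "\<exists>w. \<forall>n. (I (w n) \<and> (n = 0 \<longrightarrow> w n = (x, r))) \<and> Q (w n) (w (Suc n))"
    using succ by (intro dependent_nat_choice) auto
  then obtain w where w: "w 0 = (x, r)" "\<And>n. I (w n)" "\<And>n. Q (w n) (w (Suc n))" by blast
  define X where "X n = fst (w n)" for n
  define u where "u n = snd (w n)" for n
  have X: "X n \<in> E" "0 < u n" "u n \<le> r"
      "measure \<nu> (ball (X n) (u n)) \<le> W * (u n powr (- q) * m (X n) (u n))" for n
    using w(2)[of n] by (simp_all add: I_def X_def u_def case_prod_beta)
  have step: "l * u n \<le> u (Suc n)" "u (Suc n) \<le> u n / 8" "dist (X n) (X (Suc n)) \<le> u n / 4" for n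
    using w(3)[of n] by (simp_all add: Q_def X_def u_def case_prod_beta)
  have X0: "X 0 = x" "u 0 = r" using w(1) by (auto simp: X_def u_def)
  have u_le: "u n \<le> r * (1 / 8) ^ n" for n
  proof (induction n)
    case (Suc n)
    then show ?case using step(2)[of n] by simp
  qed (simp add: X0)
  have lim: "(\<lambda>n. r * (1 / 8) ^ n) \<longlonglongrightarrow> r * 0"
    by (intro tendsto_intros) auto
  have u_small: "\<exists>n. u n < e" if "e > 0" for e
  proof -
    have "\<forall>\<^sub>F n in sequentially. r * (1 / 8) ^ n < e"
      using order_tendstoD(2)[OF lim] that by simp
    then obtain n where "r * (1 / 8) ^ n < e" by (auto simp: eventually_sequentially)
    then show ?thesis using u_le[of n] by (intro exI[of _ n]) simp
  qed
  \<comment> \<open>Nesting of the half-radius balls gives the Cauchy property and locates the limit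
    in each of them.\<close>
  have nest1: "cball (X (Suc n)) (u (Suc n) / 2) \<subseteq> cball (X n) (u n / 2)" for n
  proof
    fix z assume "z \<in> cball (X (Suc n)) (u (Suc n) / 2)"
    then show "z \<in> cball (X n) (u n / 2)"
      using step(2,3)[of n] dist_triangle[of "X n" z "X (Suc n)"] X(2)[of n] by simp
  qed
  have nest: "cball (X i) (u i / 2) \<subseteq> cball (X n) (u n / 2)" if "n \<le> i" for n i
    using lift_Suc_antimono_le[of "\<lambda>n. cball (X n) (u n / 2)", OF nest1 that] .
  have in_cball: "X i \<in> cball (X n) (u n / 2)" if "n \<le> i" for n i
    using X(2)[of i] by (intro subsetD[OF nest[OF that]]) simp
  have "Cauchy X"
  proof (rule metric_CauchyI)
    fix e :: real assume "e > 0"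
    then obtain n where n: "u n < e" using u_small by blast
    show "\<exists>n. \<forall>i\<ge>n. \<forall>j\<ge>n. dist (X i) (X j) < e"
    proof (intro exI allI impI)
      fix i j assume "n \<le> i" "n \<le> j"
      then show "dist (X i) (X j) < e"
        using in_cball[of n i] in_cball[of n j] dist_triangle2[of "X i" "X j" "X n"] n
        by (simp add: dist_commute)
    qed
  qed
  then obtain y where y: "X \<longlonglongrightarrow> y" using compl by (auto simp: complete_def)
  have yE: "y \<in> E"
    using E y X(1) by (metis closed_sequentially)
  have y_in: "y \<in> cball (X n) (u n / 2)" for n
  proof (rule Lim_in_closed_set[OF _ _ _ y])
    show "\<forall>\<^sub>F i in sequentially. X i \<in> cball (X n) (u n / 2)"
      using in_cball by (auto simp: eventually_sequentially)
  qed auto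
  show ?thesis
  proof (rule that)
    show "y \<in> E" by fact
    show "y \<in> ball x r" using y_in[of 0] r by (simp add: X0)
    fix t assume t: "0 < t" "t \<le> r / 2"
    \<comment> \<open>The first radius below \<open>2 * t\<close>. It is not the initial one because
      \<open>t \<le> r / 2\<close>, and its predecessor satisfies
      \<open>2 * t \<le> u i < 2 * t / l\<close>.\<close>
    define n where "n = (LEAST n. u n < 2 * t)"
    have ex: "\<exists>n. u n < 2 * t" using u_small t by simp
    then have n: "u n < 2 * t" unfolding n_def by (rule LeastI_ex)
    have "n \<noteq> 0"
    proof
      assume "n = 0"
      then have "u n = r" by (simp only: X0)
      then show False using n t by simp
    qed
    then obtain i where i: "n = Suc i" by (cases n) auto
    then have "\<not> u i < 2 * t" unfolding n_def by (metis lessI not_less_Least n_def)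
    then have ui: "2 * t \<le> u i" by simp
    have lui: "l * u i < 2 * t" using step(1)[of i] n i by simp
    have d: "dist (X i) y \<le> u i / 2" using y_in[of i] by simp
    have "measure \<nu> (ball y t) \<le> measure \<nu> (ball (X i) (u i))"
    proof (rule \<nu>.finite_measure_mono)
      show "ball y t \<subseteq> ball (X i) (u i)"
      proof
        fix z assume "z \<in> ball y t"
        then show "z \<in> ball (X i) (u i)" using d ui dist_triangle[of "X i" z y] by simp
      qed
    qed (use \<nu> in auto)
    also have "\<dots> \<le> W * (u i powr (- q) * m (X i) (u i))" by (rule X)
    also have "\<dots> \<le> W * (t powr (- q) * (C ^ k * m y t))"
    proof (intro mult_left_mono mult_mono)
      show "u i powr (- q) \<le> t powr (- q)" using t ui q by (intro powr_mono2') auto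
      show "m (X i) (u i) \<le> C ^ k * m y t"
      proof (rule m_le_pow)
        \<comment> \<open>This amounts to \<open>2 * u i \<le> 2 ^ k * t\<close>, while
          \<open>dist (X i) y + u i \<le> 3 / 2 * u i\<close>.\<close>
        have "4 * u i \<le> 2 ^ k * (l * u i)" using l X(2)[of i] mult_right_mono[OF l(2), of "u i"] by simp
        also have "\<dots> \<le> 2 ^ k * (2 * t)" using lui by (intro mult_left_mono) auto
        also have "\<dots> = 2 * (2 ^ k * t)" by simp
        finally show "dist (X i) y + u i \<le> 2 ^ k * t" using d X(2)[of i] by linarith
      qed fact
    qed (use W in auto)
    finally show "measure \<nu> (ball y t) \<le> C ^ k * W * t powr (- q) * m y t" by (simp add: mult_ac)
  qed
qed

text \<open>
  Hoelder's inequality on a ball is replaced by \<open>f \<le> a + a\<^sup>1\<^sup>-\<^sup>s f\<^sup>s\<close>, where \<open>a\<close> is the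
  bound for the \<open>L\<^sup>s\<close>-mean of \<open>f\<close>.
\<close>

lemma ball_average_le:
  assumes f [measurable]: "f \<in> borel_measurable M" and f0: "\<And>z. 0 \<le> f z"
    and s: "s > 1" and t: "t > 0" and H: "H > 0"
    and int: "(\<integral>\<^sup>+ z. ennreal (f z powr s) * indicator (ball y t) z \<partial>M) \<le> ennreal (H * m y t)"
  shows "(\<integral>\<^sup>+ z. ennreal (f z * (t powr \<gamma> / m y (t / 2))) * indicator (ball y t) z \<partial>M)
    \<le> ennreal (2 * C * H powr (1 / s) * t powr \<gamma>)"
proof -
  define a where "a = H powr (1 / s)"
  have a: "a > 0" unfolding a_def using H by simp
  \<comment> \<open>Balances the two parts of the bound for \<open>f\<close>: each integrates over
    \<open>ball y t\<close> to at most \<open>a * m y t\<close>.\<close>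
  have as: "a powr (1 - s) * H = a"
  proof -
    have "a powr s = H" unfolding a_def using H s by (simp add: powr_powr)
    then show ?thesis using a H by (simp add: powr_diff)
  qed
  have fle: "f z \<le> a + a powr (1 - s) * f z powr s" for z
  proof (cases "f z \<le> a")
    case True
    then show ?thesis by (simp add: add_increasing2)
  next
    case False
    then have "f z = f z powr (1 - s) * f z powr s" using a by (simp add: powr_add[symmetric])
    also have "\<dots> \<le> a powr (1 - s) * f z powr s"
      using False a s by (intro mult_right_mono powr_mono2') auto
    finally show ?thesis using a by simp
  qed
  have m2: "m y (t / 2) > 0" using t m_pos by simp
  \<comment> \<open>For \<gamma> > 0 this factor bounds the kernel on the annulus
    \<open>t / 2 \<le> dist y z < t\<close>.\<close>
  define d where "d = t powr \<gamma> / m y (t / 2)"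
  have d: "d \<ge> 0" unfolding d_def by simp
  have "(\<integral>\<^sup>+ z. ennreal (f z * d) * indicator (ball y t) z \<partial>M)
     \<le> (\<integral>\<^sup>+ z. ennreal d * (ennreal a * indicator (ball y t) z + ennreal (a powr (1 - s)) * (ennreal (f z powr s) * indicator (ball y t) z)) \<partial>M)"
  proof (rule nn_integral_mono)
    fix z
    have "ennreal (f z * d) \<le> ennreal (d * (a + a powr (1 - s) * f z powr s))"
      using mult_right_mono[OF fle d] by (intro ennreal_leI) (simp add: mult_ac)
    also have "\<dots> = ennreal d * (ennreal a + ennreal (a powr (1 - s)) * ennreal (f z powr s))"
      using a d by (simp add: ennreal_mult ennreal_plus)
    finally show "ennreal (f z * d) * indicator (ball y t) z \<le> ennreal d * (ennreal a * indicator (ball y t) z + ennreal (a powr (1 - s)) * (ennreal (f z powr s) * indicator (ball y t) z))"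
      by (auto simp: indicator_def)
  qed
  also have "\<dots> = ennreal d * (ennreal a * emeasure M (ball y t) + ennreal (a powr (1 - s)) * (\<integral>\<^sup>+ z. ennreal (f z powr s) * indicator (ball y t) z \<partial>M))"
    by (simp add: nn_integral_cmult nn_integral_add nn_integral_cmult_indicator)
  also have "\<dots> \<le> ennreal d * (ennreal a * ennreal (m y t) + ennreal (a powr (1 - s)) * ennreal (H * m y t))"
    unfolding emeasure_ball by (intro mult_left_mono add_left_mono int) auto
  also have "\<dots> = ennreal (d * (a * m y t + a powr (1 - s) * (H * m y t)))"
    using a d H by (simp add: ennreal_mult ennreal_plus)
  also have "\<dots> \<le> ennreal (2 * C * a * t powr \<gamma>)"
  proof (rule ennreal_leI)
    have "d * (a * m y t + a powr (1 - s) * (H * m y t)) = d * (a * m y t + (a powr (1 - s) * H) * m y t)"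
      by (simp only: mult.assoc)
    also have "\<dots> = 2 * d * a * m y t" unfolding as by simp
    also have "\<dots> \<le> 2 * d * a * (C * m y (t / 2))"
      using dbl[of "t / 2" y] t a d by (intro mult_left_mono) auto
    also have "\<dots> = 2 * C * a * t powr \<gamma>" unfolding d_def using m2 by simp
    finally show "d * (a * m y t + a powr (1 - s) * (H * m y t)) \<le> 2 * C * a * t powr \<gamma>" .
  qed
  finally show ?thesis unfolding a_def d_def .
qed

text \<open>The integral is split into dyadic annuli around \<open>y\<close>. Up to \<rho>, the
  growth \<open>(\<rho> / t) powr (q / s)\<close> is beaten by \<open>t powr \<gamma>\<close> since
  \<open>q < \<gamma> * s\<close>; beyond \<rho>, the decay
  \<open>(\<rho> / t) powr (\<sigma> / s)\<close> beats \<open>t powr \<gamma>\<close> since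
  \<open>\<gamma> * s < \<sigma>\<close>. Both series are geometric, with the ratios
  \<open>x1\<close> and \<open>x2\<close>.\<close>

lemma riesz_potential_le:
  assumes f [measurable]: "f \<in> borel_measurable M" and f0: "\<And>z. 0 \<le> f z"
    and s: "s > 1" and \<gamma>: "\<gamma> > 0" "q < \<gamma> * s" "\<gamma> * s < \<sigma>" and \<rho>: "\<rho> > 0" and K: "K > 0"
    and small: "\<And>t. 0 < t \<Longrightarrow> t \<le> \<rho> \<Longrightarrow>
      (\<integral>\<^sup>+ z. ennreal (f z powr s) * indicator (ball y t) z \<partial>M) \<le> ennreal (K * (\<rho> / t) powr q * m y t)"
    and large: "\<And>t. \<rho> < t \<Longrightarrow> ennreal t \<le> 2 * ediameter (UNIV :: 'a set) \<Longrightarrow>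
      (\<integral>\<^sup>+ z. ennreal (f z powr s) * indicator (ball y t) z \<partial>M) \<le> ennreal (K * (\<rho> / t) powr \<sigma> * m y t)"
  shows "riesz_potential M \<gamma> f y \<le> ennreal (2 * C *
    (1 / (1 - 2 powr (q / s - \<gamma>)) + 1 / (1 - 2 powr (\<gamma> - \<sigma> / s))) * (K powr (1 / s) * \<rho> powr \<gamma>))"
proof -
  define U where "U t z = ennreal (f z * (t powr \<gamma> / m y (t / 2))) * indicator (ball y t) z" for t z
  have [measurable]: "U t \<in> borel_measurable M" for t unfolding U_def by measurable
  define B where "B = 2 * C * (K powr (1 / s) * \<rho> powr \<gamma>)"
  have B: "B \<ge> 0" unfolding B_def using C_gt_1 by simp
  define x1 :: real where "x1 = 2 powr (q / s - \<gamma>)"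
  define x2 :: real where "x2 = 2 powr (\<gamma> - \<sigma> / s)"
  have e: "q / s - \<gamma> < 0" "\<gamma> - \<sigma> / s < 0" using \<gamma> s by (auto simp: field_simps)
  have x1: "0 < x1" "x1 < 1" unfolding x1_def using powr_less_mono[OF e(1), of 2] by auto
  have x2: "0 < x2" "x2 < 1" unfolding x2_def using powr_less_mono[OF e(2), of 2] by auto
  define G1 where "G1 n z = U (\<rho> / 2 ^ n) z" for n :: nat and z
  \<comment> \<open>Radii above twice the diameter are switched off: \<open>large\<close> gives no
    bound there, and those annuli contain no points.\<close>
  define G2 where "G2 n z = (if ennreal (\<rho> * 2 ^ Suc n) \<le> 2 * ediameter (UNIV :: 'a set)
     then U (\<rho> * 2 ^ Suc n) z else 0)" for n :: nat and z
  have [measurable]: "G1 n \<in> borel_measurable M" "G2 n \<in> borel_measurable M" for n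
    unfolding G1_def G2_def by measurable
  have int1: "(\<integral>\<^sup>+ z. G1 n z \<partial>M) \<le> ennreal (B * x1 ^ n)" for n
  proof -
    define t where "t = \<rho> / 2 ^ n"
    have t: "t > 0" "t \<le> \<rho>" unfolding t_def using \<rho> by (auto simp: field_simps)
    have "(\<rho> / t) = 2 powr real n" unfolding t_def using \<rho> by (simp add: powr_realpow)
    then have h: "(K * (\<rho> / t) powr q) powr (1 / s) = K powr (1 / s) * 2 powr (real n * q / s)"
      using K by (simp add: powr_mult powr_powr)
    have tt: "t powr \<gamma> = \<rho> powr \<gamma> * 2 powr (- real n * \<gamma>)"
      unfolding t_def using \<rho> by (simp add: powr_divide powr_realpow[symmetric] powr_powr powr_minus field_simps)
    have "(\<integral>\<^sup>+ z. G1 n z \<partial>M) \<le> ennreal (2 * C * (K * (\<rho> / t) powr q) powr (1 / s) * t powr \<gamma>)"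
      unfolding G1_def U_def t_def[symmetric] using t K \<rho> s
      by (intro ball_average_le f f0 small) auto
    also have "2 * C * (K * (\<rho> / t) powr q) powr (1 / s) * t powr \<gamma>
        = B * (2 powr (real n * q / s) * 2 powr (- real n * \<gamma>))"
      unfolding h tt B_def by (simp add: mult_ac)
    also have "2 powr (real n * q / s) * 2 powr (- real n * \<gamma>) = x1 ^ n"
      unfolding x1_def by (simp add: powr_add[symmetric] powr_realpow[symmetric] powr_powr algebra_simps)
    finally show ?thesis .
  qed
  have int2: "(\<integral>\<^sup>+ z. G2 n z \<partial>M) \<le> ennreal (B * x2 ^ n)" for n
  proof (cases "ennreal (\<rho> * 2 ^ Suc n) \<le> 2 * ediameter (UNIV :: 'a set)")
    case True
    define t where "t = \<rho> * 2 ^ Suc n"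
    have "(1::real) < 2 ^ Suc n" by (rule one_less_power) auto
    then have t: "t > 0" "\<rho> < t" unfolding t_def using \<rho> by auto
    have "(\<rho> / t) = 2 powr (- real (Suc n))" unfolding t_def using \<rho>
      by (simp add: powr_minus powr_realpow field_simps del: of_nat_Suc)
    then have h: "(K * (\<rho> / t) powr \<sigma>) powr (1 / s) = K powr (1 / s) * 2 powr (- real (Suc n) * \<sigma> / s)"
      using K by (simp add: powr_mult powr_powr)
    have tt: "t powr \<gamma> = \<rho> powr \<gamma> * 2 powr (real (Suc n) * \<gamma>)"
      unfolding t_def using \<rho>
      by (simp add: powr_mult powr_realpow[symmetric] powr_powr del: of_nat_Suc power_Suc)
    have "(\<integral>\<^sup>+ z. G2 n z \<partial>M) = (\<integral>\<^sup>+ z. U t z \<partial>M)" unfolding G2_def t_def using True by simp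
    also have "\<dots> \<le> ennreal (2 * C * (K * (\<rho> / t) powr \<sigma>) powr (1 / s) * t powr \<gamma>)"
      unfolding U_def using t K \<rho> s True
      by (intro ball_average_le f f0 large) (auto simp: t_def)
    also have "2 * C * (K * (\<rho> / t) powr \<sigma>) powr (1 / s) * t powr \<gamma>
        = B * (2 powr (- real (Suc n) * \<sigma> / s) * 2 powr (real (Suc n) * \<gamma>))"
      unfolding h tt B_def by (simp add: mult_ac)
    also have "2 powr (- real (Suc n) * \<sigma> / s) * 2 powr (real (Suc n) * \<gamma>) = x2 ^ Suc n"
      unfolding x2_def powr_realpow[OF x2(1)[unfolded x2_def], symmetric]
      by (simp add: powr_add[symmetric] powr_powr algebra_simps add_divide_distrib diff_divide_distrib)
    also have "ennreal (B * x2 ^ Suc n) \<le> ennreal (B * x2 ^ n)"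
      using B x2 by (intro ennreal_leI mult_left_mono power_decreasing) auto
    finally show ?thesis .
  qed (simp add: G2_def)
  have geom: "(\<Sum>n. ennreal (B * x ^ n)) = ennreal (B * (1 / (1 - x)))" if "0 < x" "x < 1" for x
  proof (rule suminf_ennreal_eq)
    show "(\<lambda>n. B * x ^ n) sums (B * (1 / (1 - x)))"
      using that by (intro sums_mult geometric_sums) auto
  qed (use B that in auto)
  have dom: "ennreal (f z * ker \<gamma> y z) \<le> (\<Sum>n. G1 n z) + (\<Sum>n. G2 n z)" for z
  proof -
    define d where "d = dist y z"
    have kerU: "ennreal (f z * ker \<gamma> y z) \<le> U t z" if "t / 2 \<le> d" "d < t" "0 < d" for t
    proof -
      have "ker \<gamma> y z \<le> t powr \<gamma> / m y (t / 2)"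
        unfolding ker_def d_def[symmetric] using that \<gamma> m_pos[of "t / 2" y]
        by (intro frac_le powr_mono2 m_mono_dist) auto
      then have "f z * ker \<gamma> y z \<le> f z * (t powr \<gamma> / m y (t / 2))" using f0 by (intro mult_left_mono)
      then show ?thesis using that by (simp add: U_def d_def ennreal_leI)
    qed
    consider "d = 0" | "0 < d" "d < \<rho>" | "\<rho> \<le> d"
      using zero_le_dist[of y z] unfolding d_def by linarith
    then show ?thesis
    proof cases
      case 1
      then show ?thesis by (simp add: ker_def d_def)
    next
      case 2
      \<comment> \<open>The scale with \<open>\<rho> / 2 ^ Suc n \<le> d < \<rho> / 2 ^ n\<close>;
        for \<open>n = 0\<close> the upper bound is the case assumption.\<close>
      define n where "n = (LEAST n. \<rho> / 2 ^ Suc n \<le> d)"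
      obtain i where "\<rho> / d < 2 ^ i" using real_arch_pow[of 2 "\<rho> / d"] by auto
      then have "\<rho> / 2 ^ Suc i \<le> d" using 2 by (simp add: field_simps)
      then have n1: "\<rho> / 2 ^ Suc n \<le> d" unfolding n_def by (rule LeastI)
      have n2: "d < \<rho> / 2 ^ n"
      proof (cases n)
        case (Suc j)
        then have "\<not> \<rho> / 2 ^ Suc j \<le> d" unfolding n_def by (metis lessI not_less_Least n_def)
        then show ?thesis using Suc by simp
      qed (use 2 in simp)
      have "ennreal (f z * ker \<gamma> y z) \<le> G1 n z"
        unfolding G1_def using n1 n2 2 by (intro kerU) (auto simp: field_simps)
      also have "\<dots> \<le> (\<Sum>n. G1 n z)" using sum_le_suminf[of "\<lambda>n. G1 n z" "{n}"] by simp
      finally show ?thesis by (simp add: add_increasing2)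
    next
      case 3
      define n where "n = (LEAST n. d < \<rho> * 2 ^ Suc n)"
      obtain i where "d / \<rho> < 2 ^ i" using real_arch_pow[of 2 "d / \<rho>"] by auto
      then have "d < \<rho> * 2 ^ Suc i" using \<rho> by (simp add: field_simps)
        (smt (verit) mult_less_cancel_left_pos zero_less_power mult_pos_pos)
      then have n1: "d < \<rho> * 2 ^ Suc n" unfolding n_def by (rule LeastI)
      have n2: "\<rho> * 2 ^ n \<le> d"
      proof (cases n)
        case (Suc j)
        then have "\<not> d < \<rho> * 2 ^ Suc j" unfolding n_def by (metis lessI not_less_Least n_def)
        then show ?thesis using Suc by simp
      qed (use 3 in simp)
      \<comment> \<open>The inner radius is at most the distance \<open>d\<close>, so the outer one
        is at most twice the diameter and \<open>G2 n\<close> is switched on.\<close>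
      have "ennreal d \<le> ediameter (UNIV :: 'a set)"
        unfolding ediameter_def d_def by (intro SUP_upper2[of y] SUP_upper2[of z]) auto
      then have "2 * ennreal d \<le> 2 * ediameter (UNIV :: 'a set)" by (intro mult_left_mono) auto
      moreover have "ennreal (\<rho> * 2 ^ Suc n) \<le> ennreal (2 * d)" using n2 by (intro ennreal_leI) simp
      moreover have "ennreal (2 * d) = 2 * ennreal d" by (simp add: ennreal_mult')
      ultimately have dia: "ennreal (\<rho> * 2 ^ Suc n) \<le> 2 * ediameter (UNIV :: 'a set)"
        by (metis order_trans)
      have "ennreal (f z * ker \<gamma> y z) \<le> U (\<rho> * 2 ^ Suc n) z"
        using n1 n2 3 \<rho> by (intro kerU) auto
      also have "\<dots> = G2 n z" unfolding G2_def using dia by simp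
      also have "\<dots> \<le> (\<Sum>n. G2 n z)" using sum_le_suminf[of "\<lambda>n. G2 n z" "{n}"] by simp
      finally show ?thesis by (simp add: add_increasing)
    qed
  qed
  have "riesz_potential M \<gamma> f y \<le> (\<integral>\<^sup>+ z. (\<Sum>n. G1 n z) + (\<Sum>n. G2 n z) \<partial>M)"
    unfolding riesz_potential_ker by (intro nn_integral_mono dom)
  also have "\<dots> = (\<integral>\<^sup>+ z. (\<Sum>n. G1 n z) \<partial>M) + (\<integral>\<^sup>+ z. (\<Sum>n. G2 n z) \<partial>M)"
    by (intro nn_integral_add) measurable
  also have "(\<integral>\<^sup>+ z. (\<Sum>n. G1 n z) \<partial>M) = (\<Sum>n. \<integral>\<^sup>+ z. G1 n z \<partial>M)"
    by (rule nn_integral_suminf) measurable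
  also have "(\<integral>\<^sup>+ z. (\<Sum>n. G2 n z) \<partial>M) = (\<Sum>n. \<integral>\<^sup>+ z. G2 n z \<partial>M)"
    by (rule nn_integral_suminf) measurable
  also have "(\<Sum>n. \<integral>\<^sup>+ z. G1 n z \<partial>M) + (\<Sum>n. \<integral>\<^sup>+ z. G2 n z \<partial>M)
      \<le> (\<Sum>n. ennreal (B * x1 ^ n)) + (\<Sum>n. ennreal (B * x2 ^ n))"
    by (intro add_mono suminf_le int1 int2) auto
  also have "\<dots> = ennreal (B * (1 / (1 - x1)) + B * (1 / (1 - x2)))"
    unfolding geom[OF x1] geom[OF x2] using B x1 x2 by (intro ennreal_plus[symmetric]) auto
  also have "B * (1 / (1 - x1)) + B * (1 / (1 - x2)) = 2 * C *
    (1 / (1 - x1) + 1 / (1 - x2)) * (K powr (1 / s) * \<rho> powr \<gamma>)"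
    unfolding B_def by (simp add: algebra_simps)
  finally show ?thesis unfolding x1_def x2_def .
qed

text \<open>If some admissible \<open>f\<close> violated the bound, then
  \<open>branching_point\<close> for the measure with density \<open>f powr s\<close> would give a
  point of \<open>E\<close> in \<open>ball x r\<close> with potential at most 1/2. The means of
  \<open>f powr s\<close> there are controlled by branching up to radius \<open>r / 2\<close> and by
  reverse doubling beyond.\<close>

lemma branching_imp_riesz_capacity_ge:
  assumes br: "branching q l E" and l: "l > 0" and q: "q > 0"
    and E: "closed E" and compl: "complete (UNIV :: 'a set)"
    and s: "s > 1" and \<gamma>: "\<gamma> > 0" "q < \<gamma> * s" "\<gamma> * s < \<sigma>"
  shows "\<exists>c>0. \<forall>x\<in>E. \<forall>r>0. ennreal r < ediameter E / 8 \<longrightarrow>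
    ennreal (c * r powr (- \<gamma> * s) * m x r) \<le> riesz_capacity M \<gamma> s (E \<inter> closure (ball x r))"
proof -
  obtain k where "4 / l < 2 ^ k" using real_arch_pow[of 2 "4 / l"] by auto
  then have k: "4 \<le> 2 ^ k * l" using l by (simp add: field_simps)
  define c1 where "c1 = 2 * C * (1 / (1 - 2 powr (q / s - \<gamma>)) + 1 / (1 - 2 powr (\<gamma> - \<sigma> / s)))"
  have e: "q / s - \<gamma> < 0" "\<gamma> - \<sigma> / s < 0" using \<gamma> s by (auto simp: field_simps)
  have "(2::real) powr (q / s - \<gamma>) < 1" "(2::real) powr (\<gamma> - \<sigma> / s) < 1"
    using powr_less_mono[OF e(1), of 2] powr_less_mono[OF e(2), of 2] by auto
  then have c1: "c1 > 0" unfolding c1_def using C_gt_1 by (intro mult_pos_pos add_pos_pos) auto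
  \<comment> \<open>Dominates the constants of both ranges: the first summand for radii up to
    \<open>r / 2\<close>, the second for larger ones.\<close>
  define B where "B = C ^ k * 2 powr q + C\<^sup>2 * cs"
  have B: "B > 0" "C ^ k * 2 powr q \<le> B" "C\<^sup>2 * cs \<le> B"
    unfolding B_def using C_gt_1 cs_pos by (auto intro!: add_pos_pos)
  \<comment> \<open>Chosen so that \<open>K = c * B * r powr (- \<gamma> * s)\<close> satisfies
    \<open>c1 * K powr (1 / s) = r powr (- \<gamma>) / 2\<close>.\<close>
  define c where "c = (1 / (2 * c1)) powr s / B"
  have c: "c > 0" unfolding c_def using c1 B by simp
  show ?thesis
  proof (intro exI[of _ c] conjI ballI allI impI c)
    fix x :: 'a and r :: real
    assume x: "x \<in> E" and r: "0 < r" "ennreal r < ediameter E / 8"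
    define V where "V = c * r powr (- \<gamma> * s) * m x r"
    have V: "V > 0" unfolding V_def using c r m_pos by simp
    show "ennreal (c * r powr (- \<gamma> * s) * m x r) \<le> riesz_capacity M \<gamma> s (E \<inter> closure (ball x r))"
      unfolding riesz_capacity_def V_def[symmetric]
    proof (rule INF_greatest, rule ccontr)
      fix f assume "f \<in> {f \<in> borel_measurable M. (\<forall>x. 0 \<le> f x) \<and>
        (\<forall>x\<in>E \<inter> closure (ball x r). 1 \<le> riesz_potential M \<gamma> f x)}"
      then have f [measurable]: "f \<in> borel_measurable M" and f0: "\<And>z. 0 \<le> f z"
        and adm: "\<And>y. y \<in> E \<Longrightarrow> y \<in> closure (ball x r) \<Longrightarrow> 1 \<le> riesz_potential M \<gamma> f y" by auto
      assume "\<not> ennreal V \<le> (\<integral>\<^sup>+ z. ennreal (f z powr s) \<partial>M)"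
      then have fin: "(\<integral>\<^sup>+ z. ennreal (f z powr s) \<partial>M) \<le> ennreal V" by simp
      define \<nu> where "\<nu> = density M (\<lambda>z. ennreal (f z powr s))"
      have sets_\<nu>: "sets \<nu> = sets M" unfolding \<nu>_def by simp
      have em: "emeasure \<nu> A = (\<integral>\<^sup>+ z. ennreal (f z powr s) * indicator A z \<partial>M)" if "A \<in> sets M" for A
        unfolding \<nu>_def using that by (intro emeasure_density) auto
      have total: "emeasure \<nu> A \<le> ennreal V" if "A \<in> sets M" for A
        unfolding em[OF that] by (rule order_trans[OF nn_integral_mono fin]) (auto simp: indicator_def)
      have "emeasure \<nu> (space \<nu>) \<noteq> \<infinity>"
        using total[of "space M"] by (auto simp: \<nu>_def top_unique)
      then have \<nu>: "finite_measure \<nu>" by (rule finite_measureI)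
      interpret \<nu>: finite_measure \<nu> by fact
      \<comment> \<open>This is \<open>V\<close> divided by the \<open>q\<close>-weight of
        \<open>ball x r\<close>, so the bound on the total mass starts the descent.\<close>
      define W where "W = c * r powr (q - \<gamma> * s)"
      have W: "W > 0" unfolding W_def using c r by simp
      have "W * (r powr (- q) * m x r) = V"
        unfolding W_def V_def using r by (simp add: mult.assoc[symmetric]) (simp add: mult.assoc powr_add[symmetric])
      moreover have "measure \<nu> (ball x r) \<le> V"
        using total[of "ball x r"] V by (simp add: \<nu>.emeasure_eq_measure)
      ultimately have Wle: "measure \<nu> (ball x r) \<le> W * (r powr (- q) * m x r)" by simp
      from branching_point[OF br x r l k q E compl \<nu> sets_\<nu> less_imp_le[OF W] Wle]
      obtain y where y: "y \<in> E" "y \<in> ball x r"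
        and yt: "\<And>t. 0 < t \<Longrightarrow> t \<le> r / 2 \<Longrightarrow> measure \<nu> (ball y t) \<le> C ^ k * W * t powr (- q) * m y t"
        by blast
      define \<rho> where "\<rho> = r / 2"
      define K where "K = c * B * r powr (- \<gamma> * s)"
      have K: "K > 0" unfolding K_def using c B r by simp
      have \<rho>: "\<rho> > 0" unfolding \<rho>_def using r by simp
      have "riesz_potential M \<gamma> f y \<le> ennreal (2 * C *
          (1 / (1 - 2 powr (q / s - \<gamma>)) + 1 / (1 - 2 powr (\<gamma> - \<sigma> / s))) * (K powr (1 / s) * \<rho> powr \<gamma>))"
      proof (rule riesz_potential_le[OF f f0 s \<gamma> \<rho> K])
        fix t assume t: "0 < t" "t \<le> \<rho>"
        have "C ^ k * W * t powr (- q) \<le> K * (\<rho> / t) powr q"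
        proof -
          have "W * t powr (- q) = c * r powr (- \<gamma> * s) * (r / t) powr q"
            unfolding W_def using r t by (simp add: powr_divide powr_diff powr_minus field_simps)
          also have "(r / t) powr q = 2 powr q * (\<rho> / t) powr q"
            unfolding \<rho>_def using r t by (simp add: powr_mult[symmetric])
          finally have "C ^ k * W * t powr (- q) = (C ^ k * 2 powr q) * (c * r powr (- \<gamma> * s) * (\<rho> / t) powr q)"
            by (simp add: mult_ac)
          also have "\<dots> \<le> B * (c * r powr (- \<gamma> * s) * (\<rho> / t) powr q)"
            using B c by (intro mult_right_mono) auto
          finally show ?thesis unfolding K_def by (simp add: mult_ac)
        qed
        then have "measure \<nu> (ball y t) \<le> K * (\<rho> / t) powr q * m y t"
          using yt[of t] t unfolding \<rho>_def by (meson m_nonneg mult_right_mono order_trans)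
        then show "(\<integral>\<^sup>+ z. ennreal (f z powr s) * indicator (ball y t) z \<partial>M)
            \<le> ennreal (K * (\<rho> / t) powr q * m y t)"
          by (subst em[symmetric]) (auto simp: \<nu>.emeasure_eq_measure intro!: ennreal_leI)
      next
        fix t assume t: "\<rho> < t" "ennreal t \<le> 2 * ediameter (UNIV :: 'a set)"
        \<comment> \<open>Here only the total mass \<open>V\<close> of \<nu> enters:
          \<open>ball x r\<close> lies in \<open>ball y (4 * \<rho>)\<close>, and reverse doubling
          leads from \<rho> to \<open>t\<close>.\<close>
        have "m x r \<le> C\<^sup>2 * m y \<rho>" using y r by (intro m_le_pow) (auto simp: \<rho>_def)
        also have "\<dots> \<le> C\<^sup>2 * (cs * (\<rho> / t) powr \<sigma> * m y t)"
          using \<rho> t by (intro mult_left_mono reverse_dbl) auto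
        also have "\<dots> = (C\<^sup>2 * cs) * ((\<rho> / t) powr \<sigma> * m y t)" by (simp add: mult_ac)
        also have "\<dots> \<le> B * ((\<rho> / t) powr \<sigma> * m y t)" using B by (intro mult_right_mono) auto
        finally have "V \<le> c * r powr (- \<gamma> * s) * (B * ((\<rho> / t) powr \<sigma> * m y t))"
          unfolding V_def using c by (intro mult_left_mono) auto
        also have "\<dots> = K * (\<rho> / t) powr \<sigma> * m y t" unfolding K_def by (simp add: mult_ac)
        finally show "(\<integral>\<^sup>+ z. ennreal (f z powr s) * indicator (ball y t) z \<partial>M)
            \<le> ennreal (K * (\<rho> / t) powr \<sigma> * m y t)"
          by (subst em[symmetric]) (auto intro!: order_trans[OF total] ennreal_leI)
      qed
      also have "\<dots> = ennreal (c1 * (K powr (1 / s) * \<rho> powr \<gamma>))" unfolding c1_def ..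
      also have "K powr (1 / s) = 1 / (2 * c1) * r powr (- \<gamma>)"
      proof -
        have "c * B = (1 / (2 * c1)) powr s" unfolding c_def using B by simp
        then show ?thesis unfolding K_def using c1 s by (simp add: powr_mult powr_powr)
      qed
      also have "ennreal (c1 * (1 / (2 * c1) * r powr (- \<gamma>) * \<rho> powr \<gamma>)) \<le> ennreal (1 / 2)"
      proof (rule ennreal_leI)
        have "\<rho> powr \<gamma> \<le> r powr \<gamma>" unfolding \<rho>_def using r \<gamma> by (intro powr_mono2) auto
        then have "r powr (- \<gamma>) * \<rho> powr \<gamma> \<le> r powr (- \<gamma>) * r powr \<gamma>" by (intro mult_left_mono) auto
        also have "\<dots> = 1" using r by (simp add: powr_add[symmetric])
        finally show "c1 * (1 / (2 * c1) * r powr (- \<gamma>) * \<rho> powr \<gamma>) \<le> 1 / 2" using c1 by simp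
      qed
      finally have "riesz_potential M \<gamma> f y \<le> ennreal (1 / 2)" .
      moreover have "y \<in> closure (ball x r)" using y closure_subset by blast
      ultimately have "(1::ennreal) \<le> ennreal (1 / 2)" using adm[OF y(1)] by (meson order_trans)
      then have "(1::real) \<le> 1 / 2" by (simp only: ennreal_ge_1)
      then show False by simp
    qed
  qed
qed

section \<open>From capacity density to branching\<close>

text \<open>A \<open>t\<close>-net of \<open>cball x (r / 4)\<close> carries at least the fraction
  \<open>1 / C ^ 4\<close> of \<open>m x r\<close>, and the factor \<open>(r / t) powr q\<close>
  outweighs this loss for small \<open>t\<close>. Through this the lower capacity bound applies to
  full balls.\<close>

lemma branching_UNIV:
  assumes q: "q > 0"
  shows "\<exists>l>0. branching q l (UNIV :: 'a set)"
proof -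
  define g :: real where "g = 2 powr q"
  have g: "g > 1" unfolding g_def using q by simp
  obtain i where i: "C ^ 4 < g ^ i" using real_arch_pow[OF g] by blast
  \<comment> \<open>The extra 3 ensures \<open>t \<le> r / 8\<close>.\<close>
  define n where "n = i + 3"
  have "g ^ i \<le> g ^ n" unfolding n_def using g by (intro power_increasing) auto
  then have n: "C ^ 4 \<le> g ^ n" using i by simp
  show ?thesis
  proof (intro exI[of _ "1 / 2 ^ n"] conjI)
    show "branching q (1 / 2 ^ n) (UNIV :: 'a set)"
      unfolding branching_def
    proof (intro ballI allI impI)
      fix x :: 'a and r :: real assume r: "0 < r"
      define t where "t = r / 2 ^ n"
      have "(2::real) ^ 3 \<le> 2 ^ n" unfolding n_def by (intro power_increasing) auto
      then have "r / 2 ^ n \<le> r / 8" using r by (intro divide_left_mono) auto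
      then have t: "0 < t" "t \<le> r / 8" unfolding t_def using r by simp_all
      obtain S where S: "finite S" "S \<subseteq> cball x (r / 4)" "disjoint_family_on (\<lambda>z. ball z t) S"
        "emeasure M (\<Union>y\<in>cball x (r / 4). ball y t) \<le> ennreal (C\<^sup>2 * (\<Sum>z\<in>S. m z t))"
        using separated_net[OF order_refl r t] by blast
      have "ball x (r / 4) \<subseteq> (\<Union>y\<in>cball x (r / 4). ball y t)"
      proof
        fix z assume "z \<in> ball x (r / 4)"
        then show "z \<in> (\<Union>y\<in>cball x (r / 4). ball y t)" using t by (intro UN_I[of z]) auto
      qed
      then have "ennreal (m x (r / 4)) \<le> emeasure M (\<Union>y\<in>cball x (r / 4). ball y t)"
        unfolding emeasure_ball[symmetric] by (intro emeasure_mono) auto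
      also note S(4)
      finally have "m x (r / 4) \<le> C\<^sup>2 * (\<Sum>z\<in>S. m z t)"
        by (subst (asm) ennreal_le_iff) (auto intro!: mult_nonneg_nonneg sum_nonneg)
      then have "C\<^sup>2 * m x (r / 4) \<le> C\<^sup>2 * (C\<^sup>2 * (\<Sum>z\<in>S. m z t))" by (intro mult_left_mono) auto
      moreover have "m x r \<le> C\<^sup>2 * m x (r / 4)" using m_pow[of "r / 4" x 2] r by simp
      ultimately have "m x r \<le> C ^ 4 * (\<Sum>z\<in>S. m z t)" by (simp add: power2_eq_square power4_eq_xxxx)
      also have "\<dots> \<le> g ^ n * (\<Sum>z\<in>S. m z t)" using n by (intro mult_right_mono sum_nonneg) auto
      finally have "r powr (- q) * m x r \<le> r powr (- q) * (g ^ n * (\<Sum>z\<in>S. m z t))"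
        by (intro mult_left_mono) auto
      also have "r powr (- q) * (g ^ n * (\<Sum>z\<in>S. m z t)) = (r powr (- q) * g ^ n) * (\<Sum>z\<in>S. m z t)" by simp
      also have "r powr (- q) * g ^ n = t powr (- q)"
      proof -
        have "g ^ n = (2 ^ n) powr q"
          unfolding g_def by (simp add: powr_realpow[symmetric] powr_powr mult.commute)
        then show ?thesis unfolding t_def using r by (simp add: powr_minus powr_divide field_simps)
      qed
      finally have "r powr (- q) * m x r \<le> (\<Sum>z\<in>S. t powr (- q) * m z t)"
        by (simp add: sum_distrib_left)
      then show "\<exists>t S. 1 / 2 ^ n * r \<le> t \<and> t \<le> r / 8 \<and> finite S \<and> S \<subseteq> UNIV \<inter> cball x (r / 4) \<and>
        disjoint_family_on (\<lambda>z. ball z t) S \<and> r powr (- q) * m x r \<le> (\<Sum>z\<in>S. t powr (- q) * m z t)"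
        using S t by (intro exI[of _ t] exI[of _ S]) (auto simp: t_def)
    qed
  qed simp
qed

lemma ediameter_mono: "S \<subseteq> T \<Longrightarrow> ediameter S \<le> ediameter T"
  unfolding ediameter_def by (intro SUP_subset_mono order_refl) auto

lemma radius_bounds:
  assumes "ennreal r < ediameter (E :: 'a set) / 8"
  shows "ennreal r < ediameter (UNIV :: 'a set) / 8" "ennreal r \<le> 2 * ediameter (UNIV :: 'a set)"
proof -
  have "ediameter E / 8 \<le> ediameter (UNIV :: 'a set) / 8"
    by (intro divide_right_mono_ennreal ediameter_mono) auto
  then show 1: "ennreal r < ediameter (UNIV :: 'a set) / 8" using assms by simp
  have "d / 8 \<le> 2 * d" for d :: ennreal
  proof (rule divide_le_posI_ennreal)
    have "1 * d \<le> (8 * 2) * d" by (intro mult_right_mono) auto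
    then show "d \<le> 8 * (2 * d)" by (simp add: mult.assoc)
  qed simp
  then show "ennreal r \<le> 2 * ediameter (UNIV :: 'a set)" using 1 by (meson less_imp_le order_trans)
qed

text \<open>Density bounds the capacity of \<open>F\<close> from below by a multiple of
  \<open>Y\<close>, the \<open>b * p\<close>-weight of \<open>ball x r\<close>. If all
  \<open>N\<close> scales had weight below \<open>2 * Y\<close>, it would be at most a multiple of
  \<open>real N powr (1 - p) * Y\<close>, impossible for large \<open>N\<close>. The factor 2 gained
  at one scale pays for lowering the exponent by \<epsilon>.\<close>

lemma riesz_capacity_density_imp_branching:
  assumes dens: "riesz_capacity_density M b p E" and b: "b > 0" and p: "p > 1"
    and bp: "b * p < \<sigma>" and compl: "complete (UNIV :: 'a set)"
  shows "\<exists>q l. 0 < q \<and> q < b * p \<and> 0 < l \<and> branching q l E"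
proof -
  obtain c0 where c0: "c0 > 0" and cap: "\<And>x r. x \<in> E \<Longrightarrow> r > 0 \<Longrightarrow> ennreal r < ediameter E / 8 \<Longrightarrow>
      ennreal c0 * riesz_capacity M b p (closure (ball x r)) \<le> riesz_capacity M b p (E \<inter> closure (ball x r))"
    using dens unfolding riesz_capacity_density_def by blast
  have q': "b * p / 2 > 0" "b * p / 2 < b * p" using b p by auto
  obtain l' where l': "l' > 0" "branching (b * p / 2) l' (UNIV :: 'a set)"
    using branching_UNIV[OF q'(1)] by blast
  obtain c1 where c1: "c1 > 0" and cap_ball: "\<And>x r. r > 0 \<Longrightarrow> ennreal r < ediameter (UNIV :: 'a set) / 8 \<Longrightarrow>
      ennreal (c1 * r powr (- b * p) * m x r) \<le> riesz_capacity M b p (closure (ball x r))"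
    using branching_imp_riesz_capacity_ge[OF l'(2,1) q'(1) closed_UNIV compl p b q'(2) bp] by auto
  obtain \<eta> where eta: "0 < \<eta>" "\<eta> < 1" "cs * \<eta> powr \<sigma> \<le> 1 / 2" by (rule exists_eta)
  define A where "A = (2 / \<eta> powr b * (2 powr b / (2 powr b - 1))) powr p"
  have "(2::real) powr b > 1" using b by simp
  then have A: "A > 0" unfolding A_def using eta b by simp
  \<comment> \<open>The 2 comes from the weight \<open>2 * Y\<close>; of the four factors
    \<open>C\<close>, two come from passing between the radii \<open>r\<close> and
    \<open>r / 4\<close>, two from the nets.\<close>
  define \<Gamma> where "\<Gamma> = 2 * A * C ^ 4 / (c0 * c1)"
  have \<Gamma>: "\<Gamma> > 0" unfolding \<Gamma>_def using A C_gt_1 c0 c1 by simp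
  obtain N :: nat where N: "\<Gamma> powr (1 / (p - 1)) < real N" using reals_Archimedean2 by blast
  have N0: "N > 0" using N powr_ge_zero[of \<Gamma> "1 / (p - 1)"] by (cases N) auto
  have "\<Gamma> = (\<Gamma> powr (1 / (p - 1))) powr (p - 1)" using \<Gamma> p by (simp add: powr_powr)
  also have "\<dots> < real N powr (p - 1)" using N p by (intro powr_less_mono2) auto
  finally have N\<Gamma>: "\<Gamma> < real N powr (p - 1)" .
  \<comment> \<open>Below every ratio \<open>t k / r = 1 / 2 ^ (k + 3)\<close> with
    \<open>k < N\<close>.\<close>
  define l :: real where "l = 1 / 2 ^ (N + 3)"
  have l: "l > 0" unfolding l_def by simp
  \<comment> \<open>Small enough for \<open>l powr \<epsilon> \<ge> 1 / 2\<close>, and at most half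
    of \<open>b * p\<close> so that the new exponent stays positive.\<close>
  define \<epsilon> where "\<epsilon> = min (b * p / 2) (1 / real (N + 3))"
  have \<epsilon>: "0 < \<epsilon>" "\<epsilon> < b * p" "real (N + 3) * \<epsilon> \<le> 1" unfolding \<epsilon>_def using q' by (auto simp: min_def field_simps)
  have l\<epsilon>: "l powr \<epsilon> \<ge> 1 / 2"
  proof -
    have "(1::real) / 2 = 2 powr (- 1)" by (simp add: powr_minus)
    also have "\<dots> \<le> 2 powr (- (real (N + 3) * \<epsilon>))" using \<epsilon>(3) by (intro powr_mono) auto
    also have "\<dots> = (2 powr (- real (N + 3))) powr \<epsilon>" by (simp add: powr_powr algebra_simps)
    also have "2 powr (- real (N + 3)) = l"
      unfolding l_def by (simp only: powr_minus powr_realpow zero_less_numeral inverse_eq_divide)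
    finally show ?thesis .
  qed
  have "branching (b * p - \<epsilon>) l E" unfolding branching_def
  proof (intro ballI allI impI)
    fix x r assume x: "x \<in> E" and r: "0 < r" "ennreal r < ediameter E / 8"
    \<comment> \<open>With a quarter of the radius, points of \<open>F\<close> are admissible
      centres in a branching of \<open>ball x r\<close>.\<close>
    define F where "F = E \<inter> closure (ball x (r / 4))"
    have "closure (ball x (r / 4)) \<subseteq> cball x (r / 4)" by (rule closure_minimal) (auto simp: less_imp_le)
    then have F: "F \<subseteq> cball x (r / 4)" unfolding F_def by blast
    define t where "t k = r / 8 / 2 ^ k" for k :: nat
    have t: "0 < t k" "t k \<le> r / 8" for k
    proof -
      show "0 < t k" unfolding t_def using r by simp
      have "r / 8 / 2 ^ k \<le> r / 8 / 1" using r by (intro divide_left_mono) auto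
      then show "t k \<le> r / 8" unfolding t_def by simp
    qed
    have "\<exists>S. finite S \<and> S \<subseteq> F \<and> disjoint_family_on (\<lambda>z. ball z (t k)) S \<and>
      emeasure M (\<Union>y\<in>F. ball y (t k)) \<le> ennreal (C\<^sup>2 * (\<Sum>z\<in>S. m z (t k)))" for k
      using separated_net[OF F r(1) t, of k] by metis
    then obtain S where S: "\<And>k. finite (S k)" "\<And>k. S k \<subseteq> F"
      "\<And>k. disjoint_family_on (\<lambda>z. ball z (t k)) (S k)"
      "\<And>k. emeasure M (\<Union>y\<in>F. ball y (t k)) \<le> ennreal (C\<^sup>2 * (\<Sum>z\<in>S k. m z (t k)))"
      by metis
    define \<Sigma> where "\<Sigma> k = (\<Sum>z\<in>S k. m z (t k))" for k
    have \<Sigma>0: "\<Sigma> k \<ge> 0" for k unfolding \<Sigma>_def by (intro sum_nonneg) simp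
    define Y where "Y = r powr (- b * p) * m x r"
    have Y: "Y > 0" unfolding Y_def using r m_pos by simp
    have "\<exists>k<N. 2 * Y \<le> t k powr (- b * p) * \<Sigma> k"
    proof (rule ccontr)
      assume "\<not> ?thesis"
      then have less: "t k powr (- b * p) * \<Sigma> k \<le> 2 * Y" if "k < N" for k using that by force
      have r4: "ennreal (r / 4) < ediameter E / 8"
        using r by (intro le_less_trans[OF ennreal_leI r(2)]) simp
      have r8: "ennreal (r / 8) \<le> 2 * ediameter (UNIV :: 'a set)"
        using r by (intro order_trans[OF ennreal_leI radius_bounds(2)[OF r(2)]]) simp
      have "c0 * c1 * Y / C\<^sup>2 \<le> c0 * (c1 * (r / 4) powr (- b * p) * m x (r / 4))"
      proof -
        have "m x r \<le> C\<^sup>2 * m x (r / 4)" using m_pow[of "r / 4" x 2] r by simp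
        moreover have "r powr (- b * p) \<le> (r / 4) powr (- b * p)"
          using r b p by (intro powr_mono2') auto
        ultimately have "Y \<le> (r / 4) powr (- b * p) * (C\<^sup>2 * m x (r / 4))"
          unfolding Y_def by (intro mult_mono) auto
        then have "Y / C\<^sup>2 \<le> (r / 4) powr (- b * p) * m x (r / 4)"
          using C_gt_1 by (simp add: field_simps)
        then have "(c0 * c1) * (Y / C\<^sup>2) \<le> (c0 * c1) * ((r / 4) powr (- b * p) * m x (r / 4))"
          using c0 c1 by (intro mult_left_mono) auto
        then show ?thesis by (simp add: mult_ac)
      qed
      then have "ennreal (c0 * c1 * Y / C\<^sup>2) \<le> ennreal c0 * ennreal (c1 * (r / 4) powr (- b * p) * m x (r / 4))"
        using c0 c1 by (simp add: ennreal_mult[symmetric] ennreal_leI)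
      also have "\<dots> \<le> ennreal c0 * riesz_capacity M b p (closure (ball x (r / 4)))"
        using cap_ball[of "r / 4" x] r radius_bounds(1)[OF r4] by (intro mult_left_mono) auto
      also have "\<dots> \<le> riesz_capacity M b p F" unfolding F_def using x r r4 by (intro cap) auto
      also have "\<dots> \<le> ennreal ((2 / \<eta> powr b / real N * (2 powr b / (2 powr b - 1))) powr p) *
          (\<Sum>k<N. ennreal (t k powr (- b * p)) * emeasure M (\<Union>y\<in>F. ball y (t k)))"
        using riesz_capacity_le_scales[OF eta b _ N0 _ r8, of p F] p r unfolding t_def by simp
      also have "(2 / \<eta> powr b / real N * (2 powr b / (2 powr b - 1))) powr p = A / real N powr p"
      proof -
        have "2 / \<eta> powr b / real N * (2 powr b / (2 powr b - 1)) = (2 / \<eta> powr b * (2 powr b / (2 powr b - 1))) / real N"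
          by simp
        then show ?thesis unfolding A_def using eta b by (simp only: powr_divide)
      qed
      also have "ennreal (A / real N powr p) * (\<Sum>k<N. ennreal (t k powr (- b * p)) * emeasure M (\<Union>y\<in>F. ball y (t k)))
          \<le> ennreal (A / real N powr p) * (\<Sum>k<N. ennreal (C\<^sup>2 * (2 * Y)))"
      proof (intro mult_left_mono sum_mono)
        fix k assume "k \<in> {..<N}"
        have "ennreal (t k powr (- b * p)) * emeasure M (\<Union>y\<in>F. ball y (t k))
            \<le> ennreal (t k powr (- b * p)) * ennreal (C\<^sup>2 * \<Sigma> k)"
          unfolding \<Sigma>_def by (intro mult_left_mono S) auto
        also have "\<dots> = ennreal (C\<^sup>2 * (t k powr (- b * p) * \<Sigma> k))"
          using \<Sigma>0 by (simp add: ennreal_mult[symmetric] mult_ac)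
        also have "\<dots> \<le> ennreal (C\<^sup>2 * (2 * Y))"
          using less[of k] \<open>k \<in> {..<N}\<close> by (intro ennreal_leI mult_left_mono) auto
        finally show "ennreal (t k powr (- b * p)) * emeasure M (\<Union>y\<in>F. ball y (t k)) \<le> ennreal (C\<^sup>2 * (2 * Y))" .
      qed auto
      also have "(\<Sum>k<N. ennreal (C\<^sup>2 * (2 * Y))) = ennreal (real N * (C\<^sup>2 * (2 * Y)))"
        using Y by (subst sum_ennreal) auto
      also have "ennreal (A / real N powr p) * ennreal (real N * (C\<^sup>2 * (2 * Y)))
          = ennreal (A / real N powr p * (real N * (C\<^sup>2 * (2 * Y))))"
        using A Y by (intro ennreal_mult[symmetric]) auto
      finally have "c0 * c1 * Y / C\<^sup>2 \<le> A / real N powr p * (real N * (C\<^sup>2 * (2 * Y)))"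
        using A Y by (subst (asm) ennreal_le_iff) auto
      also have "\<dots> = A * C\<^sup>2 * 2 * Y / real N powr (p - 1)"
        using N0 by (simp add: powr_diff)
      finally have "real N powr (p - 1) * (c0 * c1) \<le> 2 * A * (C\<^sup>2 * C\<^sup>2)"
        using Y N0 C_gt_1 by (simp add: field_simps)
      then have "real N powr (p - 1) \<le> \<Gamma>"
        unfolding \<Gamma>_def using c0 c1 by (simp add: field_simps power2_eq_square power4_eq_xxxx)
      then show False using N\<Gamma> by simp
    qed
    then obtain k where k: "k < N" "2 * Y \<le> t k powr (- b * p) * \<Sigma> k" by blast
    have lt: "l * r \<le> t k"
    proof -
      have "(2::real) ^ (k + 3) \<le> 2 ^ (N + 3)" using k by (intro power_increasing) auto
      then have "r / 2 ^ (N + 3) \<le> r / 2 ^ (k + 3)" using r by (intro divide_left_mono) auto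
      then show ?thesis unfolding l_def t_def by (simp add: power_add)
    qed
    \<comment> \<open>Since \<open>t k \<ge> l * r\<close>, the factor
      \<open>t k powr \<epsilon>\<close> is at least \<open>r powr \<epsilon> / 2\<close>, and the 2
      in \<open>2 * Y\<close> absorbs this loss.\<close>
    have "r powr (- (b * p - \<epsilon>)) * m x r = r powr \<epsilon> * Y"
      unfolding Y_def using r by (simp add: powr_add[symmetric] mult.assoc[symmetric])
    also have "\<dots> \<le> (l powr \<epsilon> * 2) * (r powr \<epsilon> * Y)"
      using l\<epsilon> Y mult_right_mono[of 1 "l powr \<epsilon> * 2" "r powr \<epsilon> * Y"] by simp
    also have "\<dots> = (l * r) powr \<epsilon> * (2 * Y)" using l r by (simp add: powr_mult)
    also have "\<dots> \<le> t k powr \<epsilon> * (t k powr (- b * p) * \<Sigma> k)"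
      using lt l r \<epsilon> Y by (intro mult_mono[OF _ k(2)] powr_mono2) auto
    also have "\<dots> = t k powr (- (b * p - \<epsilon>)) * \<Sigma> k"
      unfolding mult.assoc[symmetric] powr_add[symmetric] by simp
    finally have "r powr (- (b * p - \<epsilon>)) * m x r \<le> (\<Sum>z\<in>S k. t k powr (- (b * p - \<epsilon>)) * m z (t k))"
      unfolding \<Sigma>_def by (simp add: sum_distrib_left)
    moreover have "S k \<subseteq> E \<inter> cball x (r / 4)" using S(2)[of k] F unfolding F_def by blast
    ultimately show "\<exists>t S. l * r \<le> t \<and> t \<le> r / 8 \<and> finite S \<and> S \<subseteq> E \<inter> cball x (r / 4) \<and>
        disjoint_family_on (\<lambda>z. ball z t) S \<and>
        r powr (- (b * p - \<epsilon>)) * m x r \<le> (\<Sum>z\<in>S. t powr (- (b * p - \<epsilon>)) * m z t)"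
      using S(1,3)[of k] t(2)[of k] lt by (intro exI[of _ "t k"] exI[of _ "S k"] conjI)
  qed
  then show ?thesis using \<epsilon> l by (intro exI[of _ "b * p - \<epsilon>"] exI[of _ l]) auto
qed

text \<open>The lower bound for parts of \<open>E\<close> and the upper bound for full balls are
  both multiples of \<open>r powr (- \<gamma> * s) * m x r\<close>; the quotient of their constants
  serves as density constant.\<close>

lemma branching_imp_riesz_capacity_density:
  assumes br: "branching q l E" and l: "l > 0" and q: "q > 0"
    and E: "closed E" and compl: "complete (UNIV :: 'a set)"
    and s: "s > 1" and \<gamma>: "\<gamma> > 0" "q < \<gamma> * s" "\<gamma> * s < \<sigma>"
  shows "riesz_capacity_density M \<gamma> s E"
proof -
  obtain c where c: "c > 0" and lower: "\<And>x r. x \<in> E \<Longrightarrow> r > 0 \<Longrightarrow> ennreal r < ediameter E / 8 \<Longrightarrow>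
    ennreal (c * r powr (- \<gamma> * s) * m x r) \<le> riesz_capacity M \<gamma> s (E \<inter> closure (ball x r))"
    using branching_imp_riesz_capacity_ge[OF assms] by blast
  have "s > 0" using s by simp
  then obtain c' where c': "c' > 0" and upper: "\<And>x r. r > 0 \<Longrightarrow> ennreal r \<le> 2 * ediameter (UNIV :: 'a set) \<Longrightarrow>
     riesz_capacity M \<gamma> s (closure (ball x r)) \<le> ennreal (c' * r powr (- \<gamma> * s) * m x r)"
    using riesz_capacity_ball_le[OF \<gamma>(1)] by blast
  show ?thesis unfolding riesz_capacity_density_def
  proof (intro exI[of _ "c / c'"] conjI ballI allI impI)
    fix x r assume x: "x \<in> E" and r: "0 < r" "ennreal r < ediameter E / 8"
    have "ennreal (c / c') * riesz_capacity M \<gamma> s (closure (ball x r))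
        \<le> ennreal (c / c') * ennreal (c' * r powr (- \<gamma> * s) * m x r)"
      using upper[OF r(1) radius_bounds(2)[OF r(2)]] by (intro mult_left_mono) auto
    also have "\<dots> = ennreal (c * r powr (- \<gamma> * s) * m x r)"
      using c c' by (simp add: ennreal_mult[symmetric])
    also have "\<dots> \<le> riesz_capacity M \<gamma> s (E \<inter> closure (ball x r))" using lower[OF x r] .
    finally show "ennreal (c / c') * riesz_capacity M \<gamma> s (closure (ball x r))
      \<le> riesz_capacity M \<gamma> s (E \<inter> closure (ball x r))" .
  qed (use c c' in simp)
qed

end

section \<open>Choice of \<delta> and conclusion\<close>

theorem corollary6p5:
  fixes M :: "'a::metric_space measure"
    and p \<beta> \<sigma> c\<^sub>\<sigma> :: real
    and E :: "'a set"
  assumes "doubling_metric_measure_space M"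
    and "complete (UNIV :: 'a set)"
    and "geodesic_space TYPE('a)"
    and "1 < p"
    and "0 < \<beta>" and "\<beta> \<le> 1"
    and "\<sigma> > \<beta> * p" and "c\<^sub>\<sigma> > 0"
    and "\<And>x r R. 0 < r \<Longrightarrow> r < R \<Longrightarrow> ennreal R \<le> 2 * ediameter (UNIV :: 'a set) \<Longrightarrow>
           measure M (ball x r) / measure M (ball x R) \<le> c\<^sub>\<sigma> * (r / R) powr \<sigma>"
    and "closed E"
    and "riesz_capacity_density M \<beta> p E"
  shows "\<exists>\<delta>. 0 < \<delta> \<and> \<delta> < min \<beta> (p - 1) \<and>
           (\<forall>\<gamma> s. \<beta> - \<delta> < \<gamma> \<longrightarrow> \<gamma> \<le> 1 \<longrightarrow> p - \<delta> < s \<longrightarrow> \<sigma> > \<gamma> * s \<longrightarrow>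
              riesz_capacity_density M \<gamma> s E)"
proof -
  interpret doubling_metric_measure_space M by fact
  obtain C where C: "C > 1" "\<And>x r. r > 0 \<Longrightarrow> measure M (ball x (2 * r)) \<le> C * measure M (ball x r)"
    using doubling by blast
  have "\<sigma> > 0" using assms(4,5,7) mult_pos_pos[of \<beta> p] by linarith
  interpret reverse_doubling_space M C c\<^sub>\<sigma> \<sigma>
  proof unfold_locales
    fix r R :: real and x :: 'a
    assume R: "0 < r" "r < R" "ennreal R \<le> 2 * ediameter (UNIV :: 'a set)"
    have "0 < emeasure M (ball x R)" "emeasure M (ball x R) < \<infinity>"
      using ball_pos[of R x] ball_finite[of R x] R by auto
    then have "measure M (ball x R) > 0"
      by (simp add: measure_def enn2real_positive_iff)
    then show "measure M (ball x r) \<le> c\<^sub>\<sigma> * (r / R) powr \<sigma> * measure M (ball x R)"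
      using assms(9)[OF R, of x] by (simp add: pos_divide_le_eq)
  qed (use C assms(8) \<open>\<sigma> > 0\<close> in auto)
  obtain q l where q: "0 < q" "q < \<beta> * p" and l: "0 < l" and br: "branching q l E"
    using riesz_capacity_density_imp_branching[OF assms(11,5,4,7,2)] by blast
  define w where "w = min \<beta> (p - 1)"
  \<comment> \<open>The first bound makes \<open>\<delta> < min \<beta> (p - 1)\<close> strict; the
    second keeps \<open>\<delta> * (\<beta> + p)\<close> within half of the gap
    \<open>\<beta> * p - q\<close>, so that
    \<open>q < (\<beta> - \<delta>) * (p - \<delta>)\<close>.\<close>
  define \<delta> where "\<delta> = min (w / 2) ((\<beta> * p - q) / (2 * (\<beta> + p)))"
  have "w > 0" unfolding w_def using assms(4,5) by simp
  moreover from this have "0 < \<delta>" unfolding \<delta>_def using assms(4,5) q by simp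
  moreover have "\<delta> \<le> w / 2" unfolding \<delta>_def by (rule min.cobounded1)
  ultimately have \<delta>: "0 < \<delta>" "\<delta> < min \<beta> (p - 1)" unfolding w_def[symmetric] by linarith+
  have "\<delta> \<le> (\<beta> * p - q) / (2 * (\<beta> + p))" unfolding \<delta>_def by simp
  then have "\<delta> * (2 * (\<beta> + p)) \<le> \<beta> * p - q" using assms(4,5) by (simp add: pos_le_divide_eq)
  moreover have "\<delta> * (\<beta> + p) > 0" using \<delta> assms(4,5) by simp
  ultimately have "\<delta> * (\<beta> + p) < \<beta> * p - q" by (simp add: algebra_simps)
  moreover have "(\<beta> - \<delta>) * (p - \<delta>) = \<beta> * p - \<delta> * (\<beta> + p) + \<delta> * \<delta>" by (simp add: algebra_simps)
  ultimately have prod: "q < (\<beta> - \<delta>) * (p - \<delta>)" using mult_pos_pos[OF \<delta>(1,1)] by linarith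
  show ?thesis
  proof (intro exI[of _ \<delta>] conjI allI impI \<delta>)
    fix \<gamma> s assume g: "\<beta> - \<delta> < \<gamma>" "p - \<delta> < s" "\<gamma> * s < \<sigma>"
    \<comment> \<open>Both factors on the left are positive, and \<open>p - \<delta> > 1\<close>;
      thus \<open>s > 1\<close> and \<open>q < \<gamma> * s\<close> hold for all new
      exponents.\<close>
    have "(\<beta> - \<delta>) * (p - \<delta>) \<le> \<gamma> * s" using g \<delta> by (intro mult_mono) auto
    then show "riesz_capacity_density M \<gamma> s E"
      using g \<delta> prod by (intro branching_imp_riesz_capacity_density[OF br l q(1) assms(10,2)]) auto
  qed
qed

end
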